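(* Let $\mathcal F_a'$ be a Våge space. Then the convolution is a continuous function $\mathcal F_a'\times\mathcal F_a'\to\mathcal F_a'$ in the strong topology. Hence $(\mathcal F_a',+,* )$ is a topological $\mathbb C$-algebra.
   Context: $\mathbb N=\{1,2,\dots\}$, $\mathbb N_0=\mathbb N\cup\{0\}$. For $A\subseteq\mathbb N$, $\ell_A=\mathbb N_0^{(A)}$ is the additive monoid of finitely supported functions $A\to\mathbb N_0$; $e_n$ ($n\in A$) is the element equal to $1$ at $n$ and $0$ elsewhere. A positive function $a:\ell_A\to\mathbb R$ ($a_\alpha>0$ for all $\alpha$) is admissible if $a_0=1$ and $a_{e_n}>1$ for all $n\in A$; an admissible $a$ is $d$-regular ($d\in\mathbb N$) if $\sum_{n\in A}\frac{1}{a_{e_n}^d-1}<\infty$. For $p\in\mathbb N$ let $\ell^2_{a^{-p}}=\{f=(f_\alpha)_{\alpha\in\ell_A}\in\mathbb C^{\ell_A}:\|f\|_p<\infty\}$ with $\|f\|_p=\big(\sum_{\alpha}|f_\alpha|^2a_\alpha^{-p}\big)^{1/2}$. $\mathcal F_a=\{(\varphi_\alpha):\sum_\alpha|\varphi_\alpha|^2a_\alpha^p<\infty\ \forall p\in\mathbb N\}$ is a Fréchet space with the norms $(\sum_\alpha|\varphi_\alpha|^2a_\alpha^p)^{1/2}$, $p\in\mathbb N$, and its dual is written $\mathcal F_a'=\bigcup_{p\in\mathbb N}\ell^2_{a^{-p}}$ (pairing $\sum_\alpha\varphi_\alpha\overline{f_\alpha}$); the strong topology on $\mathcal F_a'$ is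 that of uniform convergence on bounded subsets of $\mathcal F_a$. $\mathcal F_a'$ is called regular admissible if $a$ is admissible and $d$-regular for some $d\in\mathbb N$. The convolution of $f,g\in\mathbb C^{\ell_A}$ is $fg=f*g=\big(\sum_{\alpha+\beta=\gamma}f_\alpha g_\beta\big)_{\gamma\in\ell_A}$. A regular admissible space $\mathcal F_a'$ is a Våge space if there is $e\in\mathbb N$ and finite positive numbers $A(k)$, $k\ge e$, such that for all $q\in\mathbb N$ and all $p\ge q+e$, $\|fg\|_p\le A(p-q)\|f\|_q\|g\|_p$ for all $f\in\ell^2_{a^{-q}}$ and $g\in\ell^2_{a^{-p}}$. *)

theory Defs
  imports "HOL-Analysis.Analysis" "HOL-Library.Poly_Mapping" "HOL-Algebra.Algebraic_Closure_Type"
begin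

section \<open>Multi-indices and weights\<close>

type_synonym multi_index = "nat \<Rightarrow>\<^sub>0 nat"

definition ell :: "nat set \<Rightarrow> multi_index set" where
  "ell A = {\<alpha>. Poly_Mapping.keys \<alpha> \<subseteq> A}"

abbreviation unit_index :: "nat \<Rightarrow> multi_index" where
  "unit_index n \<equiv> Poly_Mapping.single n 1"

definition admissible :: "nat set \<Rightarrow> (multi_index \<Rightarrow> real) \<Rightarrow> bool" where
  "admissible A a \<longleftrightarrow>
     (\<forall>\<alpha>\<in>ell A. a \<alpha> > 0) \<and> a 0 = 1 \<and> (\<forall>n\<in>A. a (unit_index n) > 1)"

definition regular_weight :: "nat \<Rightarrow> nat set \<Rightarrow> (multi_index \<Rightarrow> real) \<Rightarrow> bool" where
  "regular_weight d A a \<longleftrightarrow> (\<lambda>n. 1 / (a (unit_index n) ^ d - 1)) summable_on A"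

definition regular_admissible :: "nat set \<Rightarrow> (multi_index \<Rightarrow> real) \<Rightarrow> bool" where
  "regular_admissible A a \<longleftrightarrow> admissible A a \<and> (\<exists>d\<ge>1. regular_weight d A a)"

section \<open>Weighted sequence spaces\<close>

text \<open>A family indexed by \<open>ell A\<close> is represented by a function on all multi-indices that
  vanishes outside \<open>ell A\<close>, so that equality of families is equality of functions.
  The integer \<open>k\<close> is the exponent of the weight.\<close>

definition weighted_l2 :: "nat set \<Rightarrow> (multi_index \<Rightarrow> real) \<Rightarrow> int \<Rightarrow> (multi_index \<Rightarrow> complex) set" where
  "weighted_l2 A a k =
     {f. (\<forall>\<alpha>. \<alpha> \<notin> ell A \<longrightarrow> f \<alpha> = 0) \<and> (\<lambda>\<alpha>. (cmod (f \<alpha>))\<^sup>2 * a \<alpha> powi k) summable_on ell A}"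

text \<open>Meaningful only on \<open>weighted_l2 A a k\<close>: outside it the sum diverges, and
  \<open>infsum\<close> returns 0.\<close>

definition weighted_norm :: "nat set \<Rightarrow> (multi_index \<Rightarrow> real) \<Rightarrow> int \<Rightarrow> (multi_index \<Rightarrow> complex) \<Rightarrow> real" where
  "weighted_norm A a k f = sqrt (\<Sum>\<^sub>\<infinity>\<alpha>\<in>ell A. (cmod (f \<alpha>))\<^sup>2 * a \<alpha> powi k)"

definition test_space :: "nat set \<Rightarrow> (multi_index \<Rightarrow> real) \<Rightarrow> (multi_index \<Rightarrow> complex) set" where
  "test_space A a = (\<Inter>p\<in>{1::nat..}. weighted_l2 A a (int p))"

definition dual_space :: "nat set \<Rightarrow> (multi_index \<Rightarrow> real) \<Rightarrow> (multi_index \<Rightarrow> complex) set" where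
  "dual_space A a = (\<Union>p\<in>{1::nat..}. weighted_l2 A a (- int p))"

definition pairing :: "nat set \<Rightarrow> (multi_index \<Rightarrow> complex) \<Rightarrow> (multi_index \<Rightarrow> complex) \<Rightarrow> complex" where
  "pairing A \<phi> f = (\<Sum>\<^sub>\<infinity>\<alpha>\<in>ell A. \<phi> \<alpha> * cnj (f \<alpha>))"

section \<open>The strong topology on the dual\<close>

definition test_bounded :: "nat set \<Rightarrow> (multi_index \<Rightarrow> real) \<Rightarrow> (multi_index \<Rightarrow> complex) set \<Rightarrow> bool" where
  "test_bounded A a B \<longleftrightarrow>
     B \<subseteq> test_space A a \<and> (\<forall>p\<ge>1::nat. \<exists>C. \<forall>\<phi>\<in>B. weighted_norm A a (int p) \<phi> \<le> C)"

definition strong_nbhd ::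
  "nat set \<Rightarrow> (multi_index \<Rightarrow> real) \<Rightarrow> (multi_index \<Rightarrow> complex) set \<Rightarrow> real
    \<Rightarrow> (multi_index \<Rightarrow> complex) \<Rightarrow> (multi_index \<Rightarrow> complex) set" where
  "strong_nbhd A a B \<epsilon> f =
     {g \<in> dual_space A a. \<forall>\<phi>\<in>B. cmod (pairing A \<phi> g - pairing A \<phi> f) < \<epsilon>}"

definition strong_topology :: "nat set \<Rightarrow> (multi_index \<Rightarrow> real) \<Rightarrow> (multi_index \<Rightarrow> complex) topology" where
  "strong_topology A a = topology (\<lambda>U. U \<subseteq> dual_space A a \<and>
     (\<forall>f\<in>U. \<exists>B \<epsilon>. test_bounded A a B \<and> \<epsilon> > 0 \<and> strong_nbhd A a B \<epsilon> f \<subseteq> U))"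

lemma test_bounded_Un:
  assumes "test_bounded A a B" "test_bounded A a C"
  shows "test_bounded A a (B \<union> C)"
  unfolding test_bounded_def
proof (intro conjI allI impI)
  show "B \<union> C \<subseteq> test_space A a"
    using assms by (auto simp: test_bounded_def)
  fix p :: nat assume "p \<ge> 1"
  then obtain M N where "\<forall>\<phi>\<in>B. weighted_norm A a (int p) \<phi> \<le> M"
      "\<forall>\<phi>\<in>C. weighted_norm A a (int p) \<phi> \<le> N"
    using assms unfolding test_bounded_def by blast
  then show "\<exists>M. \<forall>\<phi>\<in>B \<union> C. weighted_norm A a (int p) \<phi> \<le> M"
    by (intro exI[of _ "max M N"]) (auto simp: le_max_iff_disj)
qed

lemma openin_strong_topology:
  "openin (strong_topology A a) U \<longleftrightarrow> U \<subseteq> dual_space A a \<and>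
     (\<forall>f\<in>U. \<exists>B \<epsilon>. test_bounded A a B \<and> \<epsilon> > 0 \<and> strong_nbhd A a B \<epsilon> f \<subseteq> U)"
proof -
  define P where "P U \<longleftrightarrow> U \<subseteq> dual_space A a \<and>
     (\<forall>f\<in>U. \<exists>B \<epsilon>. test_bounded A a B \<and> \<epsilon> > 0 \<and> strong_nbhd A a B \<epsilon> f \<subseteq> U)" for U
  have "P (S \<inter> T)" if S: "P S" and T: "P T" for S T
    unfolding P_def
  proof (intro conjI ballI)
    show "S \<inter> T \<subseteq> dual_space A a"
      using S by (auto simp: P_def)
    fix f assume f: "f \<in> S \<inter> T"
    obtain B \<epsilon> where B: "test_bounded A a B" "\<epsilon> > 0" "strong_nbhd A a B \<epsilon> f \<subseteq> S"
      using S f by (auto simp: P_def)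
    obtain C \<delta> where C: "test_bounded A a C" "\<delta> > 0" "strong_nbhd A a C \<delta> f \<subseteq> T"
      using T f by (auto simp: P_def)
    have "strong_nbhd A a (B \<union> C) (min \<epsilon> \<delta>) f
        \<subseteq> strong_nbhd A a B \<epsilon> f \<inter> strong_nbhd A a C \<delta> f"
      by (auto simp: strong_nbhd_def)
    with B C show "\<exists>B \<epsilon>. test_bounded A a B \<and> \<epsilon> > 0 \<and> strong_nbhd A a B \<epsilon> f \<subseteq> S \<inter> T"
      by (intro exI[of _ "B \<union> C"] exI[of _ "min \<epsilon> \<delta>"]) (auto simp: test_bounded_Un)
  qed
  moreover have "P (\<Union>\<K>)" if "\<forall>K\<in>\<K>. P K" for \<K>
    using that unfolding P_def by (meson Union_iff Union_least Union_upper subset_trans)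
  ultimately have "istopology P"
    by (auto simp: istopology_def)
  then show ?thesis
    by (simp add: strong_topology_def P_def[abs_def])
qed

lemma topspace_strong_topology: "topspace (strong_topology A a) = dual_space A a"
proof (rule antisym)
  show "topspace (strong_topology A a) \<subseteq> dual_space A a"
    using openin_strong_topology openin_topspace by blast
  have "openin (strong_topology A a) (dual_space A a)"
    unfolding openin_strong_topology
  proof (intro conjI ballI subset_refl)
    fix f assume "f \<in> dual_space A a"
    have "test_bounded A a {} \<and> (1::real) > 0 \<and> strong_nbhd A a {} 1 f \<subseteq> dual_space A a"
      by (auto simp: strong_nbhd_def test_bounded_def)
    then show "\<exists>B \<epsilon>. test_bounded A a B \<and> \<epsilon> > 0 \<and> strong_nbhd A a B \<epsilon> f \<subseteq> dual_space A a"
      by blast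
  qed
  then show "dual_space A a \<subseteq> topspace (strong_topology A a)"
    by (rule openin_subset)
qed

section \<open>Convolution and Vage spaces\<close>

definition convolution ::
  "nat set \<Rightarrow> (multi_index \<Rightarrow> complex) \<Rightarrow> (multi_index \<Rightarrow> complex) \<Rightarrow> multi_index \<Rightarrow> complex" where
  "convolution A f g =
     (\<lambda>\<gamma>. \<Sum>(\<alpha>, \<beta>) \<in> {(\<alpha>, \<beta>). \<alpha> \<in> ell A \<and> \<beta> \<in> ell A \<and> \<alpha> + \<beta> = \<gamma>}. f \<alpha> * g \<beta>)"

lemma finite_convolution_index:
  "finite {(\<alpha>, \<beta>). \<alpha> \<in> ell A \<and> \<beta> \<in> ell A \<and> \<alpha> + \<beta> = (\<gamma>::multi_index)}" (is "finite ?S")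
proof -
  have inj_lookup: "inj (Poly_Mapping.lookup :: multi_index \<Rightarrow> nat \<Rightarrow> nat)"
    by (rule injI) (simp add: poly_mapping.lookup_inject)
  define F where "F = {h. \<forall>x. (x \<in> Poly_Mapping.keys \<gamma> \<longrightarrow> h x \<in> {..Poly_Mapping.lookup \<gamma> x}) \<and>
      (x \<notin> Poly_Mapping.keys \<gamma> \<longrightarrow> h x = (0::nat))}"
  have "F \<subseteq> {h. \<forall>x. (x \<in> Poly_Mapping.keys \<gamma> \<longrightarrow>
        h x \<in> {..Max (Poly_Mapping.lookup \<gamma> ` Poly_Mapping.keys \<gamma>)}) \<and>
      (x \<notin> Poly_Mapping.keys \<gamma> \<longrightarrow> h x = 0)}"
    unfolding F_def by (auto intro: order_trans Max_ge)
  then have F: "finite F"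
    by (rule finite_subset) (intro finite_set_of_finite_funs; simp)
  have "inj_on (map_prod Poly_Mapping.lookup Poly_Mapping.lookup) ?S"
    by (intro inj_on_subset[OF prod.inj_map[OF inj_lookup inj_lookup]] subset_UNIV)
  moreover have "map_prod Poly_Mapping.lookup Poly_Mapping.lookup ` ?S \<subseteq> F \<times> F"
    by (auto simp: F_def lookup_add in_keys_iff)
  ultimately show ?thesis
    using F by (meson finite_SigmaI finite_imageD finite_subset)
qed

text \<open>The norms are finite only on the corresponding spaces, so the inequality
  \<open>\<parallel>fg\<parallel>\<^sub>p \<le> K (p - q) \<parallel>f\<parallel>\<^sub>q \<parallel>g\<parallel>\<^sub>p\<close> has to include the membership of the convolution.\<close>

definition vage_space :: "nat set \<Rightarrow> (multi_index \<Rightarrow> real) \<Rightarrow> bool" where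
  "vage_space A a \<longleftrightarrow> regular_admissible A a \<and>
     (\<exists>e\<ge>1. \<exists>K :: nat \<Rightarrow> real. (\<forall>k\<ge>e. K k > 0) \<and>
        (\<forall>q\<ge>1. \<forall>p\<ge>q + e. \<forall>f\<in>weighted_l2 A a (- int q). \<forall>g\<in>weighted_l2 A a (- int p).
           convolution A f g \<in> weighted_l2 A a (- int p) \<and>
           weighted_norm A a (- int p) (convolution A f g)
             \<le> K (p - q) * weighted_norm A a (- int q) f * weighted_norm A a (- int p) g))"

section \<open>Topological algebras over the complex numbers\<close>

definition topological_complex_algebra :: "'a topology \<Rightarrow> (complex, 'a) module \<Rightarrow> bool" where
  "topological_complex_algebra T M \<longleftrightarrow>
     algebra ring_of_type_algebra M \<and> topspace T = carrier M \<and>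
     continuous_map (prod_topology T T) T (\<lambda>(x, y). x \<oplus>\<^bsub>M\<^esub> y) \<and>
     continuous_map (prod_topology euclidean T) T (\<lambda>(c, x). c \<odot>\<^bsub>M\<^esub> x) \<and>
     continuous_map (prod_topology T T) T (\<lambda>(x, y). x \<otimes>\<^bsub>M\<^esub> y)"

definition dual_algebra :: "nat set \<Rightarrow> (multi_index \<Rightarrow> real) \<Rightarrow> (complex, multi_index \<Rightarrow> complex) module" where
  "dual_algebra A a =
     \<lparr>carrier = dual_space A a,
      mult = convolution A,
      one = (\<lambda>\<gamma>. if \<gamma> = 0 then 1 else 0),
      zero = (\<lambda>\<gamma>. 0),
      add = (\<lambda>f g \<gamma>. f \<gamma> + g \<gamma>),
      smult = (\<lambda>c f \<gamma>. c * f \<gamma>)\<rparr>"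

end

(* Testing the Vage inequality on basis vectors with p = q + e and letting q tend to infinity gives
   a (x + y) >= a x * a y; hence a >= 1, and d-regularity yields convergence of the sum of a x ^ -d
   over all multi-indices x. By this nuclearity the strong topology is generated by the seminorms
   P_b f = sum of b x * |f x|, where b decreases faster than every power of a. Each such b satisfies
   b (x + y) <= b' x * b' y for another such b', so P_b (f * g) <= P_b' f * P_b' g, which makes
   convolution jointly continuous. Scalar multiplication is convolution with a multiple of the unit. *)

theory Submission
  imports Defs
begin

section \<open>Convolution\<close>

text \<open>The Vage inequality controls one pair of step norms at a time, whereas a strong
  neighbourhood meets every step of the union at once, so the step estimates do not directly give a
  neighbourhood on which products are small. The inequality is therefore exploited for what it says
  about the weight. Its constant depends only on p - q, so it stays fixed along p = q + e and
  disappears when q-th roots are taken. With inverse powers of the weight summable, square sums,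
  plain sums and suprema become interchangeable after a fixed shift of the exponent: members of the
  dual are the families growing at most like a power of a, bounded sets of test functions lie in
  boxes |\<phi>| \<le> b, and the supremum of the pairing over a box is a weighted l1 norm, for
  which convolution obeys the usual l1 estimate.\<close>

lemma zero_in_ell [simp]: "0 \<in> ell A"
  by (simp add: ell_def)

lemma add_in_ell: "\<alpha> \<in> ell A \<Longrightarrow> \<beta> \<in> ell A \<Longrightarrow> \<alpha> + \<beta> \<in> ell A"
  using Poly_Mapping.keys_add[of \<alpha> \<beta>] by (auto simp: ell_def)

lemma single_in_ell: "n \<in> A \<Longrightarrow> Poly_Mapping.single n k \<in> ell A"
  by (auto simp: ell_def)

text \<open>An abbreviation that repeats the index set of \<open>convolution\<close> literally, so
  that \<open>finite_convolution_index\<close> applies without unfolding.\<close>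

abbreviation splittings :: "nat set \<Rightarrow> multi_index \<Rightarrow> (multi_index \<times> multi_index) set" where
  "splittings A \<gamma> \<equiv> {(\<alpha>, \<beta>). \<alpha> \<in> ell A \<and> \<beta> \<in> ell A \<and> \<alpha> + \<beta> = \<gamma>}"

lemma convolution_outside: "\<gamma> \<notin> ell A \<Longrightarrow> convolution A f g \<gamma> = 0"
  by (auto simp: convolution_def intro!: sum.neutral dest: add_in_ell)

lemma convolution_commute: "convolution A f g = convolution A g f"
  unfolding convolution_def
  by (rule ext, rule sum.reindex_bij_witness[of _ prod.swap prod.swap])
     (auto simp: add.commute mult.commute)

lemma convolution_add_left:
  "convolution A (\<lambda>\<gamma>. f \<gamma> + g \<gamma>) h = (\<lambda>\<gamma>. convolution A f h \<gamma> + convolution A g h \<gamma>)"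
  by (simp add: convolution_def sum.distrib[symmetric] case_prod_unfold distrib_right)

lemma convolution_diff_left:
  "convolution A (\<lambda>\<gamma>. f \<gamma> - g \<gamma>) h = (\<lambda>\<gamma>. convolution A f h \<gamma> - convolution A g h \<gamma>)"
  by (simp add: convolution_def sum_subtractf[symmetric] case_prod_unfold left_diff_distrib)

lemma convolution_diff_right:
  "convolution A h (\<lambda>\<gamma>. f \<gamma> - g \<gamma>) = (\<lambda>\<gamma>. convolution A h f \<gamma> - convolution A h g \<gamma>)"
  by (simp add: convolution_commute[of A h] convolution_diff_left)

text \<open>Both sides sum over the triples with total \<gamma>, bracketed to the left or to the
  right; each nested sum is merged into one sum over a finite \<open>Sigma\<close> set.\<close>

lemma convolution_assoc:
  "convolution A (convolution A f g) h = convolution A f (convolution A g h)"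
proof
  fix \<gamma>
  have "convolution A (convolution A f g) h \<gamma> =
      (\<Sum>p\<in>splittings A \<gamma>. \<Sum>r\<in>splittings A (fst p). f (fst r) * g (snd r) * h (snd p))"
    by (simp add: convolution_def case_prod_unfold sum_distrib_right)
  also have "\<dots> = (\<Sum>(p, r)\<in>Sigma (splittings A \<gamma>) (\<lambda>p. splittings A (fst p)).
      f (fst r) * g (snd r) * h (snd p))"
    by (rule sum.Sigma) (auto simp: finite_convolution_index)
  also have "\<dots> = (\<Sum>(p, r)\<in>Sigma (splittings A \<gamma>) (\<lambda>p. splittings A (snd p)).
      f (fst p) * (g (fst r) * h (snd r)))"
    by (rule sum.reindex_bij_witness[of _ "\<lambda>((\<alpha>, \<tau>), (\<beta>, \<delta>)). ((\<alpha> + \<beta>, \<delta>), (\<alpha>, \<beta>))"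
          "\<lambda>((\<sigma>, \<delta>), (\<alpha>, \<beta>)). ((\<alpha>, \<beta> + \<delta>), (\<beta>, \<delta>))"])
       (auto simp: add_in_ell add.assoc mult.assoc)
  also have "\<dots> = (\<Sum>p\<in>splittings A \<gamma>. \<Sum>r\<in>splittings A (snd p).
      f (fst p) * (g (fst r) * h (snd r)))"
    by (rule sum.Sigma[symmetric]) (auto simp: finite_convolution_index)
  also have "\<dots> = convolution A f (convolution A g h) \<gamma>"
    by (simp add: convolution_def case_prod_unfold sum_distrib_left)
  finally show "convolution A (convolution A f g) h \<gamma> = convolution A f (convolution A g h) \<gamma>" .
qed

text \<open>The case c = 1 is the unit law, and general c lets scalar multiplication inherit
  properties of convolution. The support condition is there because the left side vanishes off
  \<open>ell A\<close>.\<close>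

lemma convolution_const_left:
  assumes "\<And>\<alpha>. \<alpha> \<notin> ell A \<Longrightarrow> f \<alpha> = 0"
  shows "convolution A (\<lambda>\<gamma>. if \<gamma> = 0 then c else 0) f = (\<lambda>\<gamma>. c * f \<gamma>)"
proof
  fix \<gamma>
  show "convolution A (\<lambda>\<gamma>. if \<gamma> = 0 then c else 0) f \<gamma> = c * f \<gamma>"
  proof (cases "\<gamma> \<in> ell A")
    case True
    have "convolution A (\<lambda>\<gamma>. if \<gamma> = 0 then c else 0) f \<gamma> =
        (\<Sum>(\<alpha>, \<beta>)\<in>{(0::multi_index, \<gamma>)}. (if \<alpha> = 0 then c else 0) * f \<beta>)"
      unfolding convolution_def
      by (rule sum.mono_neutral_right) (use True in \<open>auto simp: finite_convolution_index split: if_splits\<close>)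
    then show ?thesis by simp
  next
    case False
    then show ?thesis by (simp add: assms convolution_outside)
  qed
qed

text \<open>Basis vectors multiply like monomials, which turns the Vage inequality for them into an
  inequality between three values of the weight.\<close>

lemma convolution_single:
  assumes "\<alpha> \<in> ell A" "\<beta> \<in> ell A"
  shows "convolution A (\<lambda>\<gamma>. if \<gamma> = \<alpha> then 1 else 0) (\<lambda>\<gamma>. if \<gamma> = \<beta> then 1 else 0)
    = (\<lambda>\<gamma>. if \<gamma> = \<alpha> + \<beta> then 1 else 0)"
proof
  fix \<gamma>
  have "convolution A (\<lambda>\<gamma>. if \<gamma> = \<alpha> then 1 else 0) (\<lambda>\<gamma>. if \<gamma> = \<beta> then 1 else 0) \<gamma>
      = (\<Sum>p\<in>splittings A \<gamma>. if p = (\<alpha>, \<beta>) then 1 else 0)"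
    unfolding convolution_def by (rule sum.cong) (auto split: if_splits)
  also have "\<dots> = (if (\<alpha>, \<beta>) \<in> splittings A \<gamma> then 1 else 0)"
    using finite_convolution_index[of A \<gamma>] by simp
  finally show "convolution A (\<lambda>\<gamma>. if \<gamma> = \<alpha> then 1 else 0) (\<lambda>\<gamma>. if \<gamma> = \<beta> then 1 else 0) \<gamma>
      = (if \<gamma> = \<alpha> + \<beta> then 1 else 0)"
    using assms by auto
qed

text \<open>Splittings of different \<gamma> are different pairs, so the left side is one sum over a
  finite set of pairs. Nonnegativity allows that set to be enlarged to a finite rectangle, where the
  sum factors.\<close>

lemma sum_splittings_le_infsum:
  fixes u v :: "multi_index \<Rightarrow> real"
  assumes "finite F" and u: "u summable_on ell A" "\<And>\<alpha>. \<alpha> \<in> ell A \<Longrightarrow> 0 \<le> u \<alpha>"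
    and v: "v summable_on ell A" "\<And>\<alpha>. \<alpha> \<in> ell A \<Longrightarrow> 0 \<le> v \<alpha>"
  shows "(\<Sum>\<gamma>\<in>F. \<Sum>(\<alpha>, \<beta>)\<in>splittings A \<gamma>. u \<alpha> * v \<beta>) \<le> infsum u (ell A) * infsum v (ell A)"
proof -
  define S where "S = (\<Union>\<gamma>\<in>F. splittings A \<gamma>)"
  have fin: "finite S"
    using \<open>finite F\<close> unfolding S_def by (intro finite_UN_I finite_convolution_index)
  have S: "fst ` S \<subseteq> ell A" "snd ` S \<subseteq> ell A"
    by (auto simp: S_def)
  have "(\<Sum>\<gamma>\<in>F. \<Sum>(\<alpha>, \<beta>)\<in>splittings A \<gamma>. u \<alpha> * v \<beta>) = (\<Sum>(\<alpha>, \<beta>)\<in>S. u \<alpha> * v \<beta>)"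
    unfolding S_def using \<open>finite F\<close>
    by (intro sum.UNION_disjoint[symmetric]) (auto simp: finite_convolution_index)
  also have "\<dots> \<le> (\<Sum>(\<alpha>, \<beta>)\<in>fst ` S \<times> snd ` S. u \<alpha> * v \<beta>)"
    using fin S u(2) v(2) by (intro sum_mono2) (auto simp: subset_iff rev_image_eqI)
  also have "\<dots> = sum u (fst ` S) * sum v (snd ` S)"
    by (simp add: sum_product sum.cartesian_product)
  also have "\<dots> \<le> infsum u (ell A) * infsum v (ell A)"
    using fin S u v
    by (intro mult_mono finite_sum_le_infsum sum_nonneg infsum_nonneg) (auto simp: subset_iff)
  finally show ?thesis .
qed

section \<open>Supermultiplicativity of Vage weights\<close>

text \<open>One term of a convergent series with nonnegative terms is at most the sum. Membership in
  \<open>weighted_l2\<close> matters, since \<open>infsum\<close> of a divergent family is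
  0.\<close>

lemma cmod_sq_le_weighted_norm:
  assumes f: "f \<in> weighted_l2 A a k" and pos: "\<And>\<alpha>. \<alpha> \<in> ell A \<Longrightarrow> 0 < a \<alpha>" and \<alpha>: "\<alpha> \<in> ell A"
  shows "(cmod (f \<alpha>))\<^sup>2 * a \<alpha> powi k \<le> (weighted_norm A a k f)\<^sup>2"
proof -
  have nonneg: "0 \<le> (cmod (f \<beta>))\<^sup>2 * a \<beta> powi k" if "\<beta> \<in> ell A" for \<beta>
    using pos[OF that] by simp
  have "(\<Sum>\<beta>\<in>{\<alpha>}. (cmod (f \<beta>))\<^sup>2 * a \<beta> powi k) \<le> (\<Sum>\<^sub>\<infinity>\<beta>\<in>ell A. (cmod (f \<beta>))\<^sup>2 * a \<beta> powi k)"
    using f \<alpha> nonneg by (intro finite_sum_le_infsum) (auto simp: weighted_l2_def)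
  moreover have "0 \<le> (\<Sum>\<^sub>\<infinity>\<beta>\<in>ell A. (cmod (f \<beta>))\<^sup>2 * a \<beta> powi k)"
    by (rule infsum_nonneg) (rule nonneg)
  ultimately show ?thesis
    by (simp add: weighted_norm_def)
qed

lemma weighted_l2_single:
  assumes "\<alpha> \<in> ell A"
  shows "(\<lambda>\<gamma>. if \<gamma> = \<alpha> then 1 else 0) \<in> weighted_l2 A a k" (is "?e \<in> _")
    and "weighted_norm A a k (\<lambda>\<gamma>. if \<gamma> = \<alpha> then 1 else 0) = sqrt (a \<alpha> powi k)"
proof -
  have "((\<lambda>\<gamma>. (cmod (?e \<gamma>))\<^sup>2 * a \<gamma> powi k) has_sum (\<Sum>\<gamma>\<in>{\<alpha>}. (cmod (?e \<gamma>))\<^sup>2 * a \<gamma> powi k)) {\<alpha>}"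
    by (rule has_sum_finite) simp
  then have "((\<lambda>\<gamma>. (cmod (?e \<gamma>))\<^sup>2 * a \<gamma> powi k) has_sum (a \<alpha> powi k)) {\<alpha>}"
    by simp
  then have *: "((\<lambda>\<gamma>. (cmod (?e \<gamma>))\<^sup>2 * a \<gamma> powi k) has_sum (a \<alpha> powi k)) (ell A)"
    by (rule has_sum_cong_neutral[THEN iffD1, rotated -1]) (use assms in auto)
  then show "weighted_norm A a k ?e = sqrt (a \<alpha> powi k)"
    by (simp add: weighted_norm_def infsumI)
  show "?e \<in> weighted_l2 A a k"
    using * assms by (auto simp: weighted_l2_def summable_on_def)
qed

text \<open>Otherwise the powers of s / t > 1 would stay below C.\<close>

lemma le_if_powers_bounded:
  fixes s t C :: real
  assumes "0 < t" and "\<And>n. n \<ge> 1 \<Longrightarrow> s ^ n \<le> C * t ^ n"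
  shows "s \<le> t"
proof (rule ccontr)
  assume "\<not> s \<le> t"
  then have "1 < s / t"
    using \<open>0 < t\<close> by simp
  then obtain n where n: "C < (s / t) ^ n"
    using real_arch_pow by blast
  \<comment> \<open>The exponent found may be 0, where the hypothesis says nothing; the next power
    is no smaller.\<close>
  also have "\<dots> \<le> (s / t) ^ Suc n"
    using \<open>1 < s / t\<close> by (intro power_increasing) auto
  also have "\<dots> \<le> C"
    using assms(2)[of "Suc n"] \<open>0 < t\<close> by (simp add: power_divide divide_le_eq del: power_Suc)
  finally show False by simp
qed

lemma vage_space_supermultiplicative:
  assumes "vage_space A a" and \<alpha>: "\<alpha> \<in> ell A" and \<beta>: "\<beta> \<in> ell A"
  shows "a \<alpha> * a \<beta> \<le> a (\<alpha> + \<beta>)"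
proof -
  have pos: "\<And>\<alpha>. \<alpha> \<in> ell A \<Longrightarrow> 0 < a \<alpha>"
    using assms(1) by (auto simp: vage_space_def regular_admissible_def admissible_def)
  obtain e K where vage: "\<And>q p f g. \<lbrakk>1 \<le> q; q + e \<le> p; f \<in> weighted_l2 A a (- int q);
      g \<in> weighted_l2 A a (- int p)\<rbrakk> \<Longrightarrow> weighted_norm A a (- int p) (convolution A f g)
        \<le> (K (p - q) :: real) * weighted_norm A a (- int q) f * weighted_norm A a (- int p) g"
    using assms(1) unfolding vage_space_def by blast
  define x y z where "x = a \<alpha>" and "y = a \<beta>" and "z = a (\<alpha> + \<beta>)"
  have xyz: "0 < x" "0 < y" "0 < z"
    using pos \<alpha> \<beta> by (auto simp: x_def y_def z_def add_in_ell)
  \<comment> \<open>Squaring and clearing denominators leaves e surplus powers of y and z, because p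
    exceeds q by e. They join \<open>K e\<close> in a constant independent of q.\<close>
  have "(x * y) ^ q \<le> ((K e)\<^sup>2 * (z / y) ^ e) * z ^ q" if "1 \<le> q" for q
  proof -
    let ?p = "q + e"
    have "sqrt (z powi (- int ?p)) \<le> K e * sqrt (x powi (- int q)) * sqrt (y powi (- int ?p))"
      using vage[OF that order_refl weighted_l2_single(1)[OF \<alpha>] weighted_l2_single(1)[OF \<beta>]]
      by (simp add: convolution_single \<alpha> \<beta> add_in_ell weighted_l2_single(2) x_def y_def z_def
          del: of_nat_add)
    then have "(sqrt (z powi (- int ?p)))\<^sup>2
        \<le> (K e * sqrt (x powi (- int q)) * sqrt (y powi (- int ?p)))\<^sup>2"
      by (rule power_mono) (use xyz in simp)
    then have "inverse (z ^ ?p) \<le> (K e)\<^sup>2 * inverse (x ^ q) * inverse (y ^ ?p)"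
      using xyz by (simp add: power_mult_distrib power_int_minus del: of_nat_add)
    then show ?thesis
      using xyz by (simp add: field_simps power_add power_mult_distrib)
  qed
  then have "x * y \<le> z"
    by (rule le_if_powers_bounded[OF xyz(3)])
  then show ?thesis by (simp add: x_def y_def z_def)
qed

section \<open>Reduction to unit indices and summability of inverse powers of the weight\<close>

lemma sum_single_lookup:
  assumes "finite S" "Poly_Mapping.keys \<alpha> \<subseteq> S"
  shows "(\<Sum>n\<in>S. Poly_Mapping.single n (Poly_Mapping.lookup \<alpha> n)) = \<alpha>"
proof (rule poly_mapping_eqI)
  fix k
  show "Poly_Mapping.lookup (\<Sum>n\<in>S. Poly_Mapping.single n (Poly_Mapping.lookup \<alpha> n)) k
      = Poly_Mapping.lookup \<alpha> k"
    using assms by (auto simp: lookup_sum lookup_single when_def in_keys_iff)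
qed

text \<open>Supermultiplicativity is iterated over the copies of each variable and then over the
  variables; \<open>a 0 = 1\<close> starts both inductions. This reduces questions on the weight to
  the unit indices, the only ones that regularity speaks about.\<close>

lemma vage_space_prod_le:
  assumes "vage_space A a" and S: "finite S" "S \<subseteq> A"
  shows "(\<Prod>n\<in>S. a (unit_index n) ^ k n) \<le> a (\<Sum>n\<in>S. Poly_Mapping.single n (k n))"
proof -
  note super = vage_space_supermultiplicative[OF assms(1)]
  have adm: "a 0 = 1" "\<And>n. n \<in> A \<Longrightarrow> 1 < a (unit_index n)"
      "\<And>\<alpha>. \<alpha> \<in> ell A \<Longrightarrow> 0 < a \<alpha>"
    using assms(1) by (auto simp: vage_space_def regular_admissible_def admissible_def)
  have single: "a (unit_index n) ^ k \<le> a (Poly_Mapping.single n k)" if "n \<in> A" for n k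
  proof (induction k)
    case (Suc k)
    have "a (unit_index n) ^ Suc k \<le> a (unit_index n) * a (Poly_Mapping.single n k)"
      using Suc adm(2)[OF that] by simp
    also have "\<dots> \<le> a (Poly_Mapping.single n (Suc k))"
      using super[of "unit_index n" "Poly_Mapping.single n k"] that
      by (simp add: single_in_ell single_add[symmetric])
    finally show ?case .
  qed (simp add: adm)
  show ?thesis
    using S
  proof (induction S)
    case (insert n S)
    have S: "(\<Sum>n\<in>S. Poly_Mapping.single n (k n)) \<in> ell A"
      using keys_sum[of "\<lambda>n. Poly_Mapping.single n (k n)" S] insert.prems
      by (auto simp: ell_def split: if_splits)
    have "(\<Prod>n\<in>insert n S. a (unit_index n) ^ k n)
        \<le> a (Poly_Mapping.single n (k n)) * a (\<Sum>n\<in>S. Poly_Mapping.single n (k n))"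
      unfolding prod.insert[OF insert.hyps]
    proof (rule mult_mono)
      show "0 \<le> (\<Prod>n\<in>S. a (unit_index n) ^ k n)"
        using insert.prems by (intro prod_nonneg zero_le_power less_imp_le adm(3) single_in_ell) auto
      show "0 \<le> a (Poly_Mapping.single n (k n))"
        using insert.prems by (intro less_imp_le adm(3) single_in_ell) auto
    qed (use insert single in auto)
    also have "\<dots> \<le> a (\<Sum>n\<in>insert n S. Poly_Mapping.single n (k n))"
      using super[OF _ S, of "Poly_Mapping.single n (k n)"] insert by (simp add: single_in_ell)
    finally show ?case .
  qed (simp add: adm)
qed

text \<open>Admissibility gives this bound only at 0 and at the unit indices; the product bound
  spreads it. It makes the powers of the weight increase with the exponent.\<close>

lemma vage_space_weight_ge_one:
  assumes "vage_space A a" and "\<alpha> \<in> ell A"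
  shows "1 \<le> a \<alpha>"
proof -
  have "1 \<le> (\<Prod>n\<in>Poly_Mapping.keys \<alpha>. a (unit_index n) ^ Poly_Mapping.lookup \<alpha> n)"
    using assms
    by (intro prod_ge_1 one_le_power less_imp_le)
       (auto simp: ell_def vage_space_def regular_admissible_def admissible_def)
  also have "\<dots> \<le> a (\<Sum>n\<in>Poly_Mapping.keys \<alpha>. Poly_Mapping.single n (Poly_Mapping.lookup \<alpha> n))"
    using assms by (intro vage_space_prod_le) (auto simp: ell_def)
  finally show ?thesis
    by (simp add: sum_single_lookup)
qed

text \<open>Expanding \<open>\<Prod>n. 1 / (1 - a (unit_index n) ^ - d)\<close> into geometric series dominates the sum of
  the \<open>a \<alpha> ^ - d\<close>, and \<open>1 / (1 - 1 / t) = 1 + 1 / (t - 1) \<le> exp (1 / (t - 1))\<close>.\<close>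

lemma vage_space_inverse_summable:
  assumes vage: "vage_space A a"
  shows "\<exists>d. (\<lambda>\<alpha>. 1 / a \<alpha> ^ d) summable_on ell A"
proof -
  obtain d where "d \<ge> 1" and reg: "(\<lambda>n. 1 / (a (unit_index n) ^ d - 1)) summable_on A"
    using vage by (auto simp: vage_space_def regular_admissible_def regular_weight_def)
  have unit: "1 < a (unit_index n)" if "n \<in> A" for n
    using vage that by (auto simp: vage_space_def regular_admissible_def admissible_def)
  define t where "t n = a (unit_index n) ^ d" for n
  have t: "1 < t n" if "n \<in> A" for n
    using unit[OF that] \<open>d \<ge> 1\<close> by (simp add: t_def one_less_power)
  define C where "C = exp (\<Sum>\<^sub>\<infinity>n\<in>A. 1 / (t n - 1))"
  have "(\<Sum>\<alpha>\<in>F. 1 / a \<alpha> ^ d) \<le> C" if "finite F" "F \<subseteq> ell A" for F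
  proof -
    \<comment> \<open>F lies in a finite box: supports within S, exponents at most N. The inserted 0
      keeps \<open>Max\<close> away from the empty set.\<close>
    define S where "S = (\<Union>\<alpha>\<in>F. Poly_Mapping.keys \<alpha>)"
    define N where "N = Max (insert 0 ((\<lambda>(\<alpha>, n). Poly_Mapping.lookup \<alpha> n) ` (F \<times> S)))"
    have S: "finite S" "S \<subseteq> A"
      using that by (auto simp: S_def ell_def)
    have N: "Poly_Mapping.lookup \<alpha> n \<le> N" if "\<alpha> \<in> F" "n \<in> S" for \<alpha> n
      unfolding N_def using that S \<open>finite F\<close> by (intro Max_ge) auto
    \<comment> \<open>Restriction to the common set S makes the exponents extensional, as
      \<open>Pi\<^sub>E\<close> demands; an index in F is recovered from them.\<close>
    let ?r = "\<lambda>\<alpha>. restrict (Poly_Mapping.lookup \<alpha>) S"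
    have recover: "(\<Sum>n\<in>S. Poly_Mapping.single n (?r \<alpha> n)) = \<alpha>" if "\<alpha> \<in> F" for \<alpha>
      using sum_single_lookup[OF S(1), of \<alpha>] that by (auto simp: S_def)
    have inj: "inj_on ?r F"
      by (rule inj_on_inverseI[where g = "\<lambda>r. \<Sum>n\<in>S. Poly_Mapping.single n (r n)"]) (rule recover)
    have "(\<Sum>\<alpha>\<in>F. 1 / a \<alpha> ^ d) \<le> (\<Sum>\<alpha>\<in>F. \<Prod>n\<in>S. (1 / t n) ^ ?r \<alpha> n)"
    proof (rule sum_mono)
      fix \<alpha> assume "\<alpha> \<in> F"
      have "(\<Prod>n\<in>S. a (unit_index n) ^ ?r \<alpha> n) ^ d \<le> a \<alpha> ^ d"
        using vage_space_prod_le[OF vage S, of "?r \<alpha>"] recover[OF \<open>\<alpha> \<in> F\<close>] unit S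
        by (intro power_mono prod_nonneg) (auto simp: less_imp_le subset_iff intro!: zero_le_power order_trans[OF zero_le_one])
      moreover have "0 < (\<Prod>n\<in>S. a (unit_index n) ^ ?r \<alpha> n) ^ d"
        using unit S by (intro zero_less_power prod_pos) (auto intro!: zero_less_power less_trans[OF zero_less_one])
      ultimately have "1 / a \<alpha> ^ d \<le> 1 / (\<Prod>n\<in>S. a (unit_index n) ^ ?r \<alpha> n) ^ d"
        by (intro divide_left_mono) auto
      also have "\<dots> = (\<Prod>n\<in>S. (1 / t n) ^ ?r \<alpha> n)"
        by (simp add: t_def prod_power_distrib prod_dividef power_one_over power_mult[symmetric]
            mult.commute inverse_eq_divide[symmetric] prod_inversef[symmetric] power_inverse o_def)
      finally show "1 / a \<alpha> ^ d \<le> (\<Prod>n\<in>S. (1 / t n) ^ ?r \<alpha> n)" .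
    qed
    also have "\<dots> = (\<Sum>r\<in>?r ` F. \<Prod>n\<in>S. (1 / t n) ^ r n)"
      using inj by (simp add: sum.reindex)
    \<comment> \<open>Passing to the full box only adds nonnegative terms and lets distributivity
      turn the sum into a product of truncated geometric series.\<close>
    also have "\<dots> \<le> (\<Sum>r\<in>Pi\<^sub>E S (\<lambda>_. {..N}). \<Prod>n\<in>S. (1 / t n) ^ r n)"
    proof (rule sum_mono2)
      show "?r ` F \<subseteq> Pi\<^sub>E S (\<lambda>_. {..N})"
        using N by auto
      show "0 \<le> (\<Prod>n\<in>S. (1 / t n) ^ r n)" for r
        using t S by (intro prod_nonneg zero_le_power) (auto intro!: less_imp_le less_trans[OF zero_less_one])
    qed (use S in \<open>auto intro: finite_PiE\<close>)
    also have "\<dots> = (\<Prod>n\<in>S. \<Sum>j\<in>{..N}. (1 / t n) ^ j)"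
      using S by (simp add: prod_sum_PiE)
    also have "\<dots> \<le> (\<Prod>n\<in>S. exp (1 / (t n - 1)))"
    proof (rule prod_mono, intro conjI)
      fix n assume "n \<in> S"
      then have tn: "1 < t n" using t S by auto
      show "0 \<le> (\<Sum>j\<in>{..N}. (1 / t n) ^ j)"
        using tn by (intro sum_nonneg) auto
      have "(\<Sum>j\<in>{..N}. (1 / t n) ^ j) \<le> suminf (power (1 / t n))"
        using tn by (intro sum_le_suminf summable_geometric) auto
      also have "\<dots> = 1 + 1 / (t n - 1)"
        using tn by (subst suminf_geometric) (auto simp: field_simps)
      also have "\<dots> \<le> exp (1 / (t n - 1))"
        by (rule exp_ge_add_one_self)
      finally show "(\<Sum>j\<in>{..N}. (1 / t n) ^ j) \<le> exp (1 / (t n - 1))" .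
    qed
    also have "\<dots> = exp (\<Sum>n\<in>S. 1 / (t n - 1))"
      using S by (simp add: exp_sum)
    \<comment> \<open>Here d-regularity enters: the bound becomes independent of F.\<close>
    also have "\<dots> \<le> C"
      unfolding C_def exp_le_cancel_iff
      using S reg t by (intro finite_sum_le_infsum) (auto simp: t_def less_imp_le)
    finally show ?thesis .
  qed
  moreover have "0 \<le> 1 / a \<alpha> ^ d" if "\<alpha> \<in> ell A" for \<alpha>
    using vage_space_weight_ge_one[OF vage that] by simp
  ultimately have "(\<lambda>\<alpha>. 1 / a \<alpha> ^ d) summable_on ell A"
    by (intro nonneg_bdd_above_summable_on bdd_aboveI2[where M = C]) auto
  then show ?thesis ..
qed

section \<open>Duals of supermultiplicative weights\<close>

text \<open>What the topological argument takes from the Vage inequality and from regularity. The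
  exponent d stays existential because it only shifts other exponents.\<close>

locale supermultiplicative_weight =
  fixes A :: "nat set" and a :: "multi_index \<Rightarrow> real"
  assumes weight_ge_one: "\<alpha> \<in> ell A \<Longrightarrow> 1 \<le> a \<alpha>"
    and weight_supermult: "\<lbrakk>\<alpha> \<in> ell A; \<beta> \<in> ell A\<rbrakk> \<Longrightarrow> a \<alpha> * a \<beta> \<le> a (\<alpha> + \<beta>)"
    and weight_summable: "\<exists>d. (\<lambda>\<alpha>. 1 / a \<alpha> ^ d) summable_on ell A"
begin

lemma weight_pos: "\<alpha> \<in> ell A \<Longrightarrow> 0 < a \<alpha>"
  using weight_ge_one by force

lemma weight_power_mono: "\<alpha> \<in> ell A \<Longrightarrow> p \<le> q \<Longrightarrow> a \<alpha> ^ p \<le> a \<alpha> ^ q"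
  by (simp add: weight_ge_one power_increasing)

lemma weight_le_add:
  assumes "\<alpha> \<in> ell A" "\<beta> \<in> ell A"
  shows "a \<alpha> \<le> a (\<alpha> + \<beta>)"
  using mult_left_mono[OF weight_ge_one[OF assms(2)] less_imp_le[OF weight_pos[OF assms(1)]]]
    weight_supermult[OF assms] by linarith

text \<open>The exponents in \<open>dual_space\<close> start at 1, so a positive d is wanted;
  raising d by one only shrinks the terms, as the weight is at least 1.\<close>

lemma weight_summableE:
  obtains d where "d \<ge> 1" "(\<lambda>\<alpha>. 1 / a \<alpha> ^ d) summable_on ell A"
proof -
  obtain d where d: "(\<lambda>\<alpha>. 1 / a \<alpha> ^ d) summable_on ell A"
    using weight_summable ..
  have "(\<lambda>\<alpha>. 1 / a \<alpha> ^ Suc d) summable_on ell A"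
  proof (rule summable_on_comparison_test[OF d])
    fix \<alpha> assume \<alpha>: "\<alpha> \<in> ell A"
    show "1 / a \<alpha> ^ Suc d \<le> 1 / a \<alpha> ^ d"
      using weight_power_mono[OF \<alpha>, of d "Suc d"] weight_pos[OF \<alpha>]
      by (intro divide_left_mono) auto
    show "0 \<le> 1 / a \<alpha> ^ Suc d"
      using weight_pos[OF \<alpha>] by simp
  qed
  then show thesis by (rule that[rotated]) simp
qed

text \<open>With summable inverse powers, a weighted square sum and a pointwise bound by a power of
  the weight differ only in the exponent. Pointwise growth is the form in which closure under the
  operations is easy to check.\<close>

lemma dual_space_iff:
  "f \<in> dual_space A a \<longleftrightarrow>
     (\<forall>\<alpha>. \<alpha> \<notin> ell A \<longrightarrow> f \<alpha> = 0) \<and> (\<exists>p C. \<forall>\<alpha>\<in>ell A. cmod (f \<alpha>) \<le> C * a \<alpha> ^ p)"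
  (is "?L \<longleftrightarrow> ?R")
proof
  assume ?L
  then obtain p :: nat where f: "f \<in> weighted_l2 A a (- int p)"
    by (auto simp: dual_space_def)
  let ?N = "weighted_norm A a (- int p) f"
  have N: "0 \<le> ?N"
    unfolding weighted_norm_def by (intro real_sqrt_ge_zero infsum_nonneg) (simp add: weight_pos less_imp_le)
  have "cmod (f \<alpha>) \<le> ?N * a \<alpha> ^ p" if \<alpha>: "\<alpha> \<in> ell A" for \<alpha>
  proof (rule power2_le_imp_le)
    have "(cmod (f \<alpha>))\<^sup>2 \<le> ?N\<^sup>2 * a \<alpha> ^ p"
      using cmod_sq_le_weighted_norm[OF f weight_pos \<alpha>] weight_pos[OF \<alpha>]
      by (simp add: power_int_minus field_simps)
    \<comment> \<open>Doubling the exponent, harmless as the weight is at least 1, makes the bound a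
      perfect square.\<close>
    also have "\<dots> \<le> ?N\<^sup>2 * a \<alpha> ^ (2 * p)"
      using weight_power_mono[OF \<alpha>, of p "2 * p"] by (intro mult_left_mono) auto
    finally show "(cmod (f \<alpha>))\<^sup>2 \<le> (?N * a \<alpha> ^ p)\<^sup>2"
      by (simp add: power_mult_distrib power_mult[symmetric] mult.commute)
    show "0 \<le> ?N * a \<alpha> ^ p"
      using N weight_pos[OF \<alpha>] by simp
  qed
  then show ?R
    using f by (auto simp: weighted_l2_def)
next
  assume R: ?R
  then obtain p C where C: "\<And>\<alpha>. \<alpha> \<in> ell A \<Longrightarrow> cmod (f \<alpha>) \<le> C * a \<alpha> ^ p"
    by blast
  obtain d where d: "d \<ge> 1" "(\<lambda>\<alpha>. 1 / a \<alpha> ^ d) summable_on ell A"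
    by (rule weight_summableE)
  \<comment> \<open>Of the exponent, \<open>2 * p\<close> absorbs the square of the growth bound and
    d leaves the summable series.\<close>
  have "(\<lambda>\<alpha>. (cmod (f \<alpha>))\<^sup>2 * a \<alpha> powi (- int (2 * p + d))) summable_on ell A"
  proof (rule summable_on_comparison_test[OF summable_on_cmult_right[OF d(2), of "C\<^sup>2"]])
    fix \<alpha> assume \<alpha>: "\<alpha> \<in> ell A"
    have "(cmod (f \<alpha>))\<^sup>2 \<le> (C * a \<alpha> ^ p)\<^sup>2"
      by (intro power_mono C \<alpha>) simp
    then have "(cmod (f \<alpha>))\<^sup>2 / a \<alpha> ^ (2 * p + d) \<le> (C * a \<alpha> ^ p)\<^sup>2 / a \<alpha> ^ (2 * p + d)"
      using weight_pos[OF \<alpha>] by (intro divide_right_mono) auto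
    also have "\<dots> = C\<^sup>2 * (1 / a \<alpha> ^ d)"
      using weight_pos[OF \<alpha>]
      by (simp add: power_mult_distrib power_add power_mult[symmetric] mult.commute)
    finally show "(cmod (f \<alpha>))\<^sup>2 * a \<alpha> powi (- int (2 * p + d)) \<le> C\<^sup>2 * (1 / a \<alpha> ^ d)"
      by (simp add: power_int_minus divide_inverse del: of_nat_add of_nat_mult)
  qed (simp add: weight_pos less_imp_le)
  then have "f \<in> weighted_l2 A a (- int (2 * p + d))"
    using R by (simp add: weighted_l2_def)
  then show ?L
    unfolding dual_space_def using d(1) by (intro UN_I[of "2 * p + d"]) auto
qed

lemma dual_space_outside: "f \<in> dual_space A a \<Longrightarrow> \<alpha> \<notin> ell A \<Longrightarrow> f \<alpha> = 0"
  by (simp add: dual_space_iff)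

text \<open>The index 0 always lies in \<open>ell A\<close>, and the bound there forces the constant
  to be nonnegative.\<close>

lemma dual_space_boundE:
  assumes "f \<in> dual_space A a"
  obtains p C where "0 \<le> C" "\<And>\<alpha>. \<alpha> \<in> ell A \<Longrightarrow> cmod (f \<alpha>) \<le> C * a \<alpha> ^ p"
proof -
  obtain p C where C: "\<And>\<alpha>. \<alpha> \<in> ell A \<Longrightarrow> cmod (f \<alpha>) \<le> C * a \<alpha> ^ p"
    using assms by (auto simp: dual_space_iff)
  have "0 \<le> C * a 0 ^ p"
    using C[of 0] norm_ge_zero[of "f 0"] by (simp del: norm_ge_zero)
  then have "0 \<le> C"
    using zero_less_power[OF weight_pos[OF zero_in_ell], of p] by (simp add: zero_le_mult_iff)
  then show thesis using C that by blast
qed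

lemma dual_space_add:
  assumes "f \<in> dual_space A a" "g \<in> dual_space A a"
  shows "(\<lambda>\<gamma>. f \<gamma> + g \<gamma>) \<in> dual_space A a"
proof -
  obtain p C where f: "0 \<le> C" "\<And>\<alpha>. \<alpha> \<in> ell A \<Longrightarrow> cmod (f \<alpha>) \<le> C * a \<alpha> ^ p"
    using assms(1) by (rule dual_space_boundE) blast
  obtain q D where g: "0 \<le> D" "\<And>\<alpha>. \<alpha> \<in> ell A \<Longrightarrow> cmod (g \<alpha>) \<le> D * a \<alpha> ^ q"
    using assms(2) by (rule dual_space_boundE) blast
  have "cmod (f \<alpha> + g \<alpha>) \<le> (C + D) * a \<alpha> ^ (p + q)" if \<alpha>: "\<alpha> \<in> ell A" for \<alpha>
  proof -
    have "cmod (f \<alpha> + g \<alpha>) \<le> C * a \<alpha> ^ p + D * a \<alpha> ^ q"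
      by (rule order_trans[OF norm_triangle_ineq add_mono[OF f(2) g(2)]]) (rule \<alpha>)+
    also have "\<dots> \<le> C * a \<alpha> ^ (p + q) + D * a \<alpha> ^ (p + q)"
      using f(1) g(1) by (intro add_mono mult_left_mono weight_power_mono \<alpha>) auto
    finally show ?thesis by (simp add: distrib_right)
  qed
  then show ?thesis
    using assms by (auto simp: dual_space_iff)
qed

lemma dual_space_scale:
  assumes "f \<in> dual_space A a"
  shows "(\<lambda>\<gamma>. c * f \<gamma>) \<in> dual_space A a"
proof -
  obtain p C where "\<And>\<alpha>. \<alpha> \<in> ell A \<Longrightarrow> cmod (f \<alpha>) \<le> C * a \<alpha> ^ p"
    using assms by (auto simp: dual_space_iff)
  then have "\<And>\<alpha>. \<alpha> \<in> ell A \<Longrightarrow> cmod (c * f \<alpha>) \<le> (cmod c * C) * a \<alpha> ^ p"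
    by (simp add: norm_mult mult.assoc mult_left_mono)
  then show ?thesis
    using assms unfolding dual_space_iff by (auto simp del: norm_mult)
qed

lemma dual_space_diff:
  assumes "f \<in> dual_space A a" "g \<in> dual_space A a"
  shows "(\<lambda>\<gamma>. f \<gamma> - g \<gamma>) \<in> dual_space A a"
  using dual_space_add[OF assms(1) dual_space_scale[OF assms(2), of "-1"]] by simp

lemma dual_space_const: "(\<lambda>\<gamma>. if \<gamma> = 0 then c else 0) \<in> dual_space A a"
proof -
  have "\<forall>\<alpha>\<in>ell A. cmod (if \<alpha> = 0 then c else 0) \<le> cmod c * a \<alpha> ^ 0"
    by auto
  then show ?thesis
    unfolding dual_space_iff by (metis zero_in_ell)
qed

lemma dual_space_zero: "(\<lambda>\<gamma>. 0) \<in> dual_space A a"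
  using dual_space_const[of 0] by simp

text \<open>Growth exponents add, and supermultiplicativity moves the powers of
  \<open>a \<alpha> * a \<beta>\<close> to \<open>a \<gamma>\<close>. A further power d is spent on
  the factors \<open>1 / a \<alpha> ^ d\<close> and \<open>1 / a \<beta> ^ d\<close>, so that their
  sum over the splittings is bounded independently of \<gamma>.\<close>

lemma dual_space_convolution:
  assumes "f \<in> dual_space A a" "g \<in> dual_space A a"
  shows "convolution A f g \<in> dual_space A a"
proof -
  obtain p C where f: "0 \<le> C" "\<And>\<alpha>. \<alpha> \<in> ell A \<Longrightarrow> cmod (f \<alpha>) \<le> C * a \<alpha> ^ p"
    using assms(1) by (rule dual_space_boundE) blast
  obtain q D where g: "0 \<le> D" "\<And>\<alpha>. \<alpha> \<in> ell A \<Longrightarrow> cmod (g \<alpha>) \<le> D * a \<alpha> ^ q"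
    using assms(2) by (rule dual_space_boundE) blast
  obtain d where d: "(\<lambda>\<alpha>. 1 / a \<alpha> ^ d) summable_on ell A"
    using weight_summable ..
  let ?r = "p + q + d" and ?W = "\<Sum>\<^sub>\<infinity>\<alpha>\<in>ell A. 1 / a \<alpha> ^ d"
  have bound: "cmod (f \<alpha> * g \<beta>) \<le> (C * D * a (\<alpha> + \<beta>) ^ ?r) * (1 / a \<alpha> ^ d * (1 / a \<beta> ^ d))"
    if \<alpha>: "\<alpha> \<in> ell A" and \<beta>: "\<beta> \<in> ell A" for \<alpha> \<beta>
  proof -
    have pos: "0 < a \<alpha>" "0 < a \<beta>"
      using \<alpha> \<beta> weight_pos by auto
    have "cmod (f \<alpha> * g \<beta>) \<le> (C * a \<alpha> ^ p) * (D * a \<beta> ^ q)"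
      unfolding norm_mult using f g \<alpha> \<beta> pos by (intro mult_mono) auto
    also have "\<dots> \<le> (C * a \<alpha> ^ (p + q)) * (D * a \<beta> ^ (p + q))"
      using f(1) g(1) pos \<alpha> \<beta> by (intro mult_mono mult_left_mono weight_power_mono) auto
    also have "\<dots> = (C * D * (a \<alpha> * a \<beta>) ^ ?r) * (1 / a \<alpha> ^ d * (1 / a \<beta> ^ d))"
      using pos by (simp add: power_add power_mult_distrib field_simps)
    also have "\<dots> \<le> (C * D * a (\<alpha> + \<beta>) ^ ?r) * (1 / a \<alpha> ^ d * (1 / a \<beta> ^ d))"
      using f(1) g(1) pos weight_supermult[OF \<alpha> \<beta>]
      by (intro mult_right_mono mult_left_mono power_mono) auto
    finally show ?thesis .
  qed
  have "cmod (convolution A f g \<gamma>) \<le> (C * D * (?W * ?W)) * a \<gamma> ^ ?r" if \<gamma>: "\<gamma> \<in> ell A" for \<gamma>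
  proof -
    have "cmod (convolution A f g \<gamma>)
        \<le> (\<Sum>(\<alpha>, \<beta>)\<in>splittings A \<gamma>. (C * D * a \<gamma> ^ ?r) * (1 / a \<alpha> ^ d * (1 / a \<beta> ^ d)))"
      unfolding convolution_def using bound by (intro sum_norm_le) auto
    \<comment> \<open>The outer sum over a single \<gamma> only brings the expression into the form
      of \<open>sum_splittings_le_infsum\<close>.\<close>
    also have "\<dots> = (C * D * a \<gamma> ^ ?r) *
        (\<Sum>\<gamma>\<in>{\<gamma>}. \<Sum>(\<alpha>, \<beta>)\<in>splittings A \<gamma>. 1 / a \<alpha> ^ d * (1 / a \<beta> ^ d))"
      by (simp add: sum_distrib_left case_prod_unfold)
    also have "\<dots> \<le> (C * D * a \<gamma> ^ ?r) * (?W * ?W)"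
      using f(1) g(1) weight_pos[OF \<gamma>] d weight_pos
      by (intro mult_left_mono sum_splittings_le_infsum mult_nonneg_nonneg) (auto simp: less_imp_le)
    finally show ?thesis by (simp add: mult_ac)
  qed
  then show ?thesis
    unfolding dual_space_iff using convolution_outside by blast
qed

subsection \<open>Seminorms of rapidly decreasing weights\<close>

text \<open>Restricted to \<open>ell A\<close>, these are exactly the nonnegative members of the
  test space, again by exchanging square sums for suprema. The case p = 0 makes b bounded.\<close>

definition rapidly_decreasing :: "(multi_index \<Rightarrow> real) \<Rightarrow> bool" where
  "rapidly_decreasing b \<longleftrightarrow>
     (\<forall>\<alpha>\<in>ell A. 0 \<le> b \<alpha>) \<and> (\<forall>p::nat. \<exists>C. \<forall>\<alpha>\<in>ell A. b \<alpha> * a \<alpha> ^ p \<le> C)"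

text \<open>For rapidly decreasing b, on the dual space, this is the supremum of the moduli of the
  pairing over all \<phi> with |\<phi>| \<le> b. Elsewhere the sum may diverge, and
  \<open>infsum\<close> then returns 0.\<close>

definition seminorm :: "(multi_index \<Rightarrow> real) \<Rightarrow> (multi_index \<Rightarrow> complex) \<Rightarrow> real" where
  "seminorm b f = (\<Sum>\<^sub>\<infinity>\<alpha>\<in>ell A. b \<alpha> * cmod (f \<alpha>))"

definition seminorm_ball ::
  "(multi_index \<Rightarrow> real) \<Rightarrow> (multi_index \<Rightarrow> complex) \<Rightarrow> real \<Rightarrow> (multi_index \<Rightarrow> complex) set" where
  "seminorm_ball b f \<epsilon> = {g \<in> dual_space A a. seminorm b (\<lambda>\<alpha>. g \<alpha> - f \<alpha>) < \<epsilon>}"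

lemma rapidly_decreasing_nonneg: "rapidly_decreasing b \<Longrightarrow> \<alpha> \<in> ell A \<Longrightarrow> 0 \<le> b \<alpha>"
  by (simp add: rapidly_decreasing_def)

lemma seminorm_summable:
  assumes b: "rapidly_decreasing b" and f: "f \<in> dual_space A a"
  shows "(\<lambda>\<alpha>. b \<alpha> * cmod (f \<alpha>)) summable_on ell A"
proof -
  obtain p C where C: "0 \<le> C" "\<And>\<alpha>. \<alpha> \<in> ell A \<Longrightarrow> cmod (f \<alpha>) \<le> C * a \<alpha> ^ p"
    using f by (rule dual_space_boundE) blast
  obtain d where d: "(\<lambda>\<alpha>. 1 / a \<alpha> ^ d) summable_on ell A"
    using weight_summable ..
  \<comment> \<open>The power p cancels the growth of f, the power d makes the series
    converge.\<close>
  obtain D where D: "\<And>\<alpha>. \<alpha> \<in> ell A \<Longrightarrow> b \<alpha> * a \<alpha> ^ (p + d) \<le> D"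
    using b unfolding rapidly_decreasing_def by blast
  show ?thesis
  proof (rule summable_on_comparison_test[OF summable_on_cmult_right[OF d, of "C * D"]])
    fix \<alpha> assume \<alpha>: "\<alpha> \<in> ell A"
    note nonneg = rapidly_decreasing_nonneg[OF b \<alpha>]
    have "b \<alpha> * cmod (f \<alpha>) \<le> b \<alpha> * (C * a \<alpha> ^ p)"
      by (intro mult_left_mono C \<alpha> nonneg)
    also have "\<dots> = C * (b \<alpha> * a \<alpha> ^ (p + d)) * (1 / a \<alpha> ^ d)"
      using weight_pos[OF \<alpha>] by (simp add: power_add)
    also have "\<dots> \<le> C * D * (1 / a \<alpha> ^ d)"
      using weight_pos[OF \<alpha>] C(1) D[OF \<alpha>] by (intro mult_right_mono mult_left_mono) auto
    finally show "b \<alpha> * cmod (f \<alpha>) \<le> C * D * (1 / a \<alpha> ^ d)" .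
    show "0 \<le> b \<alpha> * cmod (f \<alpha>)"
      using nonneg by simp
  qed
qed

lemma seminorm_nonneg: "rapidly_decreasing b \<Longrightarrow> 0 \<le> seminorm b f"
  unfolding seminorm_def by (intro infsum_nonneg) (simp add: rapidly_decreasing_nonneg)

lemma seminorm_zero [simp]: "seminorm b (\<lambda>\<alpha>. 0) = 0"
  by (simp add: seminorm_def)

lemma seminorm_triangle:
  assumes b: "rapidly_decreasing b" and "f \<in> dual_space A a" "g \<in> dual_space A a"
  shows "seminorm b (\<lambda>\<alpha>. f \<alpha> + g \<alpha>) \<le> seminorm b f + seminorm b g"
proof -
  note summable = seminorm_summable[OF b]
  have "seminorm b (\<lambda>\<alpha>. f \<alpha> + g \<alpha>) \<le> (\<Sum>\<^sub>\<infinity>\<alpha>\<in>ell A. b \<alpha> * cmod (f \<alpha>) + b \<alpha> * cmod (g \<alpha>))"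
    unfolding seminorm_def
    by (intro infsum_mono summable_on_add summable dual_space_add assms(2,3))
       (simp add: distrib_left[symmetric] mult_left_mono norm_triangle_ineq rapidly_decreasing_nonneg[OF b])
  also have "\<dots> = seminorm b f + seminorm b g"
    unfolding seminorm_def by (intro infsum_add summable assms(2,3))
  finally show ?thesis .
qed

lemma seminorm_const: "seminorm b (\<lambda>\<gamma>. if \<gamma> = 0 then c else 0) = b 0 * cmod c"
proof -
  have "seminorm b (\<lambda>\<gamma>. if \<gamma> = 0 then c else 0)
      = (\<Sum>\<^sub>\<infinity>\<gamma>\<in>{0}. b \<gamma> * cmod (if \<gamma> = 0 then c else 0))"
    unfolding seminorm_def by (rule infsum_cong_neutral) auto
  then show ?thesis by simp
qed

text \<open>Since \<open>a \<alpha> \<le> a (\<alpha> + \<beta>)\<close>, the envelope \<open>b' \<alpha> = (SUP \<beta>. sqrt (b (\<alpha> + \<beta>)))\<close> is again rapidly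
  decreasing, and \<open>b (\<alpha> + \<beta>) \<le> b' \<alpha> * b' \<beta>\<close>.\<close>

lemma rapidly_decreasing_factor:
  assumes b: "rapidly_decreasing b"
  shows "\<exists>b'. rapidly_decreasing b' \<and> (\<forall>\<alpha>\<in>ell A. \<forall>\<beta>\<in>ell A. b (\<alpha> + \<beta>) \<le> b' \<alpha> * b' \<beta>)"
proof -
  define b' where "b' \<alpha> = (SUP \<beta>\<in>ell A. sqrt (b (\<alpha> + \<beta>)))" for \<alpha>
  note nonneg = rapidly_decreasing_nonneg[OF b]
  have ne: "ell A \<noteq> {}"
    using zero_in_ell by blast
  \<comment> \<open>The bound is uniform in \<beta>. Exponent \<open>2 * p\<close> is taken from b
    because the square root halves it.\<close>
  have bound: "\<exists>C. \<forall>\<alpha>\<in>ell A. \<forall>\<beta>\<in>ell A. sqrt (b (\<alpha> + \<beta>)) \<le> C / a \<alpha> ^ p" for p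
  proof -
    obtain C where C: "\<And>\<alpha>. \<alpha> \<in> ell A \<Longrightarrow> b \<alpha> * a \<alpha> ^ (2 * p) \<le> C"
      using b unfolding rapidly_decreasing_def by blast
    have "sqrt (b (\<alpha> + \<beta>)) \<le> sqrt C / a \<alpha> ^ p" if "\<alpha> \<in> ell A" "\<beta> \<in> ell A" for \<alpha> \<beta>
    proof -
      have ab: "\<alpha> + \<beta> \<in> ell A"
        using that by (rule add_in_ell)
      have "b (\<alpha> + \<beta>) * a \<alpha> ^ (2 * p) \<le> b (\<alpha> + \<beta>) * a (\<alpha> + \<beta>) ^ (2 * p)"
        using that weight_pos
        by (intro mult_left_mono power_mono weight_le_add nonneg ab) (auto simp: less_imp_le)
      also have "\<dots> \<le> C"
        by (rule C) (rule ab)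
      finally have "sqrt (b (\<alpha> + \<beta>) * (a \<alpha> ^ p)\<^sup>2) \<le> sqrt C"
        by (simp add: power_mult[symmetric] mult.commute)
      then show ?thesis
        using weight_pos[OF that(1)] by (simp add: real_sqrt_mult field_simps)
    qed
    then show ?thesis by blast
  qed
  have upper: "sqrt (b (\<alpha> + \<beta>)) \<le> b' \<alpha>" if \<alpha>: "\<alpha> \<in> ell A" and \<beta>: "\<beta> \<in> ell A" for \<alpha> \<beta>
  proof -
    \<comment> \<open>The case p = 0 bounds the family of square roots, so that the supremum is a
      true upper bound.\<close>
    obtain C where "\<And>\<beta>. \<beta> \<in> ell A \<Longrightarrow> sqrt (b (\<alpha> + \<beta>)) \<le> C / a \<alpha> ^ 0"
      using bound[of 0] \<alpha> by blast
    then show ?thesis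
      unfolding b'_def using \<beta> by (intro cSUP_upper bdd_aboveI2)
  qed
  have b'_nonneg: "0 \<le> b' \<alpha>" if "\<alpha> \<in> ell A" for \<alpha>
    using upper[OF that zero_in_ell] nonneg[OF that] order_trans[of 0 "sqrt (b \<alpha>)" "b' \<alpha>"] by simp
  have "\<exists>C. \<forall>\<alpha>\<in>ell A. b' \<alpha> * a \<alpha> ^ p \<le> C" for p
  proof -
    obtain C where C: "\<And>\<alpha> \<beta>. \<lbrakk>\<alpha> \<in> ell A; \<beta> \<in> ell A\<rbrakk> \<Longrightarrow> sqrt (b (\<alpha> + \<beta>)) \<le> C / a \<alpha> ^ p"
      using bound[of p] by blast
    have "b' \<alpha> * a \<alpha> ^ p \<le> C" if "\<alpha> \<in> ell A" for \<alpha>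
    proof -
      have "b' \<alpha> \<le> C / a \<alpha> ^ p"
        unfolding b'_def by (intro cSUP_least ne C that)
      then show ?thesis
        using weight_pos[OF that] by (simp add: field_simps)
    qed
    then show ?thesis by blast
  qed
  then have "rapidly_decreasing b'"
    using b'_nonneg by (simp add: rapidly_decreasing_def)
  moreover have "b (\<alpha> + \<beta>) \<le> b' \<alpha> * b' \<beta>" if "\<alpha> \<in> ell A" "\<beta> \<in> ell A" for \<alpha> \<beta>
  proof -
    have nn: "0 \<le> b (\<alpha> + \<beta>)"
      using that by (intro nonneg add_in_ell)
    \<comment> \<open>One root is read as a shift of \<alpha> by \<beta>, the other as a shift of
      \<beta> by \<alpha>.\<close>
    then have "b (\<alpha> + \<beta>) = sqrt (b (\<alpha> + \<beta>)) * sqrt (b (\<beta> + \<alpha>))"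
      by (simp add: add.commute)
    also have "\<dots> \<le> b' \<alpha> * b' \<beta>"
      using that nn by (intro mult_mono upper b'_nonneg) (auto simp: add.commute)
    finally show ?thesis .
  qed
  ultimately show ?thesis by blast
qed

text \<open>On every splitting of \<gamma> the factor \<open>b \<gamma>\<close> is at most
  \<open>b' \<alpha> * b' \<beta>\<close>, which decouples the double sum. The price is the passage
  from b to b'.\<close>

lemma seminorm_convolution_le:
  assumes b: "rapidly_decreasing b" and b': "rapidly_decreasing b'"
    and factor: "\<forall>\<alpha>\<in>ell A. \<forall>\<beta>\<in>ell A. b (\<alpha> + \<beta>) \<le> b' \<alpha> * b' \<beta>"
    and f: "f \<in> dual_space A a" and g: "g \<in> dual_space A a"
  shows "seminorm b (convolution A f g) \<le> seminorm b' f * seminorm b' g"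
  unfolding seminorm_def[of b]
proof (rule infsum_le_finite_sums)
  show "(\<lambda>\<gamma>. b \<gamma> * cmod (convolution A f g \<gamma>)) summable_on ell A"
    by (intro seminorm_summable b dual_space_convolution f g)
  fix F assume F: "finite F" "F \<subseteq> ell A"
  have "(\<Sum>\<gamma>\<in>F. b \<gamma> * cmod (convolution A f g \<gamma>))
      \<le> (\<Sum>\<gamma>\<in>F. \<Sum>(\<alpha>, \<beta>)\<in>splittings A \<gamma>. (b' \<alpha> * cmod (f \<alpha>)) * (b' \<beta> * cmod (g \<beta>)))"
  proof (rule sum_mono)
    fix \<gamma> assume "\<gamma> \<in> F"
    then have "b \<gamma> * cmod (convolution A f g \<gamma>)
        \<le> b \<gamma> * (\<Sum>(\<alpha>, \<beta>)\<in>splittings A \<gamma>. cmod (f \<alpha>) * cmod (g \<beta>))"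
      unfolding convolution_def using F
      by (intro mult_left_mono rapidly_decreasing_nonneg[OF b] sum_norm_le) (auto simp: norm_mult)
    also have "\<dots> = (\<Sum>(\<alpha>, \<beta>)\<in>splittings A \<gamma>. b \<gamma> * (cmod (f \<alpha>) * cmod (g \<beta>)))"
      by (simp add: sum_distrib_left case_prod_unfold)
    also have "\<dots> \<le> (\<Sum>(\<alpha>, \<beta>)\<in>splittings A \<gamma>. (b' \<alpha> * b' \<beta>) * (cmod (f \<alpha>) * cmod (g \<beta>)))"
      using factor by (intro sum_mono) (auto intro!: mult_right_mono)
    finally show "b \<gamma> * cmod (convolution A f g \<gamma>)
        \<le> (\<Sum>(\<alpha>, \<beta>)\<in>splittings A \<gamma>. (b' \<alpha> * cmod (f \<alpha>)) * (b' \<beta> * cmod (g \<beta>)))"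
      by (simp add: mult_ac)
  qed
  also have "\<dots> \<le> seminorm b' f * seminorm b' g"
    unfolding seminorm_def using F b' f g
    by (intro sum_splittings_le_infsum seminorm_summable) (auto simp: rapidly_decreasing_nonneg)
  finally show "(\<Sum>\<gamma>\<in>F. b \<gamma> * cmod (convolution A f g \<gamma>)) \<le> seminorm b' f * seminorm b' g" .
qed

subsection \<open>The strong topology\<close>

text \<open>For rapidly decreasing b these boxes form a fundamental system of bounded sets of the
  test space, as the next two lemmas establish, so uniform convergence need only be tested on
  them.\<close>

definition dominated :: "(multi_index \<Rightarrow> real) \<Rightarrow> (multi_index \<Rightarrow> complex) set" where
  "dominated b = {\<phi>. (\<forall>\<alpha>. \<alpha> \<notin> ell A \<longrightarrow> \<phi> \<alpha> = 0) \<and> (\<forall>\<alpha>\<in>ell A. cmod (\<phi> \<alpha>) \<le> b \<alpha>)}"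

lemma test_bounded_dominated:
  assumes b: "rapidly_decreasing b"
  shows "test_bounded A a (dominated b)"
proof -
  obtain d where d: "(\<lambda>\<alpha>. 1 / a \<alpha> ^ d) summable_on ell A"
    using weight_summable ..
  have *: "\<exists>C. \<forall>\<phi>\<in>dominated b. \<phi> \<in> weighted_l2 A a (int p) \<and> weighted_norm A a (int p) \<phi> \<le> C" for p
  proof -
    obtain C where C: "\<And>\<alpha>. \<alpha> \<in> ell A \<Longrightarrow> b \<alpha> * a \<alpha> ^ (p + d) \<le> C"
      using b unfolding rapidly_decreasing_def by blast
    have bound: "(cmod (\<phi> \<alpha>))\<^sup>2 * a \<alpha> powi int p \<le> C\<^sup>2 * (1 / a \<alpha> ^ d)"
      if \<phi>: "\<phi> \<in> dominated b" and \<alpha>: "\<alpha> \<in> ell A" for \<phi> \<alpha>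
    proof -
      have pos: "0 < a \<alpha>" by (rule weight_pos[OF \<alpha>])
      \<comment> \<open>Only exponent p is asked for; the extra d yields a summable majorant common
        to the whole box, and doubling the exponent completes a square.\<close>
      have "(cmod (\<phi> \<alpha>))\<^sup>2 * a \<alpha> ^ (p + d) \<le> (cmod (\<phi> \<alpha>))\<^sup>2 * a \<alpha> ^ (2 * (p + d))"
        by (intro mult_left_mono weight_power_mono \<alpha>) auto
      also have "\<dots> = (cmod (\<phi> \<alpha>) * a \<alpha> ^ (p + d))\<^sup>2"
        by (simp add: power_mult_distrib power_mult[symmetric] mult.commute)
      also have "\<dots> \<le> C\<^sup>2"
      proof (rule power_mono)
        show "cmod (\<phi> \<alpha>) * a \<alpha> ^ (p + d) \<le> C"
          using \<phi> \<alpha> pos by (intro order_trans[OF mult_right_mono C]) (auto simp: dominated_def)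
      qed (use pos in simp)
      finally show ?thesis
        using pos by (simp add: power_add field_simps)
    qed
    have "\<phi> \<in> weighted_l2 A a (int p) \<and> weighted_norm A a (int p) \<phi>
        \<le> sqrt (\<Sum>\<^sub>\<infinity>\<alpha>\<in>ell A. C\<^sup>2 * (1 / a \<alpha> ^ d))" if \<phi>: "\<phi> \<in> dominated b" for \<phi>
    proof -
      have "(\<lambda>\<alpha>. (cmod (\<phi> \<alpha>))\<^sup>2 * a \<alpha> powi int p) summable_on ell A"
        by (rule summable_on_comparison_test[OF summable_on_cmult_right[OF d] bound[OF \<phi>]])
           (auto simp: weight_pos less_imp_le)
      moreover from this have "(\<Sum>\<^sub>\<infinity>\<alpha>\<in>ell A. (cmod (\<phi> \<alpha>))\<^sup>2 * a \<alpha> powi int p)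
          \<le> (\<Sum>\<^sub>\<infinity>\<alpha>\<in>ell A. C\<^sup>2 * (1 / a \<alpha> ^ d))"
        by (intro infsum_mono summable_on_cmult_right[OF d] bound[OF \<phi>])
      ultimately show ?thesis
        using \<phi> by (auto simp: weighted_l2_def weighted_norm_def dominated_def)
    qed
    then show ?thesis by blast
  qed
  show ?thesis
    unfolding test_bounded_def
  proof (intro conjI allI impI)
    show "dominated b \<subseteq> test_space A a"
      using * unfolding test_space_def by blast
    show "\<exists>C. \<forall>\<phi>\<in>dominated b. weighted_norm A a (int p) \<phi> \<le> C" for p
      using *[of p] by blast
  qed
qed

text \<open>The majorant is the pointwise supremum over B. A norm bound shared by all of B controls
  each coordinate, and the bounds for growing exponents make the supremum decay rapidly.\<close>

lemma test_bounded_subset_dominated: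
  assumes B: "test_bounded A a B"
  obtains b where "rapidly_decreasing b" "B \<subseteq> dominated b"
proof -
  have test: "\<phi> \<in> weighted_l2 A a (int p)" if "\<phi> \<in> B" "p \<ge> 1" for \<phi> p
    using B that unfolding test_bounded_def test_space_def by blast
  \<comment> \<open>The zero function keeps the supremum over a nonempty set when B is empty, and
    makes b nonnegative.\<close>
  define b where "b \<alpha> = (SUP \<phi>\<in>insert (\<lambda>_. 0) B. cmod (\<phi> \<alpha>))" for \<alpha>
  have bound: "\<exists>C. \<forall>\<alpha>\<in>ell A. \<forall>\<phi>\<in>insert (\<lambda>_. 0) B. cmod (\<phi> \<alpha>) \<le> C / a \<alpha> ^ p" for p
  proof -
    \<comment> \<open>Squaring doubles the exponent; \<open>Suc\<close> is there because norm bounds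
      are available only from exponent 1 on, while p may be 0.\<close>
    let ?p = "2 * Suc p"
    obtain C where C: "\<And>\<phi>. \<phi> \<in> B \<Longrightarrow> weighted_norm A a (int ?p) \<phi> \<le> C"
      using B[unfolded test_bounded_def, THEN conjunct2, rule_format, of ?p] by force
    \<comment> \<open>C may be negative when B is empty, and the zero function has to obey the bound
      too.\<close>
    have "cmod (\<phi> \<alpha>) \<le> max C 0 / a \<alpha> ^ p" if \<alpha>: "\<alpha> \<in> ell A" and \<phi>: "\<phi> \<in> B" for \<alpha> \<phi>
    proof -
      have pos: "0 < a \<alpha>" by (rule weight_pos[OF \<alpha>])
      have "(cmod (\<phi> \<alpha>))\<^sup>2 * a \<alpha> ^ ?p \<le> (weighted_norm A a (int ?p) \<phi>)\<^sup>2"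
        using cmod_sq_le_weighted_norm[OF test[OF \<phi>, of ?p] weight_pos \<alpha>]
        by (simp only: power_int_of_nat) simp
      also have "\<dots> \<le> (max C 0)\<^sup>2"
        by (rule power_mono) (use C[OF \<phi>] in \<open>auto simp: weighted_norm_def
            intro!: infsum_nonneg simp: weight_pos less_imp_le\<close>)
      finally have "(cmod (\<phi> \<alpha>) * a \<alpha> ^ Suc p)\<^sup>2 \<le> (max C 0)\<^sup>2"
        by (simp only: power_mult_distrib power_mult[symmetric] mult.commute[of "Suc p"])
      then have "cmod (\<phi> \<alpha>) * a \<alpha> ^ Suc p \<le> max C 0"
        by (rule power2_le_imp_le) simp
      moreover have "cmod (\<phi> \<alpha>) * a \<alpha> ^ p \<le> cmod (\<phi> \<alpha>) * a \<alpha> ^ Suc p"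
        by (intro mult_left_mono weight_power_mono \<alpha>) auto
      ultimately show ?thesis
        using pos by (simp add: field_simps)
    qed
    moreover have "0 \<le> max C 0 / a \<alpha> ^ p" if "\<alpha> \<in> ell A" for \<alpha>
      using weight_pos[OF that] by simp
    ultimately have "\<forall>\<alpha>\<in>ell A. \<forall>\<phi>\<in>insert (\<lambda>_. 0) B. cmod (\<phi> \<alpha>) \<le> max C 0 / a \<alpha> ^ p"
      by auto
    then show ?thesis ..
  qed
  have upper: "cmod (\<phi> \<alpha>) \<le> b \<alpha>" if \<alpha>: "\<alpha> \<in> ell A" and \<phi>: "\<phi> \<in> insert (\<lambda>_. 0) B" for \<phi> \<alpha>
  proof -
    obtain C where "\<forall>\<alpha>\<in>ell A. \<forall>\<phi>\<in>insert (\<lambda>_. 0) B. cmod (\<phi> \<alpha>) \<le> C / a \<alpha> ^ 0"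
      using bound[of 0] ..
    then have "bdd_above ((\<lambda>\<phi>. cmod (\<phi> \<alpha>)) ` insert (\<lambda>_. 0) B)"
      using \<alpha> by (intro bdd_aboveI2[where M = "C / a \<alpha> ^ 0"]) (drule (1) bspec, erule (1) bspec)
    then show ?thesis
      unfolding b_def by (rule cSUP_upper[OF \<phi>])
  qed
  have "\<exists>C. \<forall>\<alpha>\<in>ell A. b \<alpha> * a \<alpha> ^ p \<le> C" for p
  proof -
    obtain C where C: "\<forall>\<alpha>\<in>ell A. \<forall>\<phi>\<in>insert (\<lambda>_. 0) B. cmod (\<phi> \<alpha>) \<le> C / a \<alpha> ^ p"
      using bound[of p] ..
    have "b \<alpha> * a \<alpha> ^ p \<le> C" if "\<alpha> \<in> ell A" for \<alpha>
    proof -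
      have "b \<alpha> \<le> C / a \<alpha> ^ p"
        unfolding b_def by (intro cSUP_least C[rule_format] that) auto
      then show ?thesis
        using weight_pos[OF that] by (simp add: field_simps)
    qed
    then show ?thesis by blast
  qed
  moreover have "0 \<le> b \<alpha>" if "\<alpha> \<in> ell A" for \<alpha>
    using upper[OF that, of "\<lambda>_. 0"] by simp
  ultimately have "rapidly_decreasing b"
    by (simp add: rapidly_decreasing_def)
  moreover have "B \<subseteq> dominated b"
    using upper test[of _ 1] by (auto simp: dominated_def weighted_l2_def)
  ultimately show thesis by (rule that)
qed

section \<open>Pairings with the members of a box\<close>

lemma pairing_abs_summable:
  assumes "rapidly_decreasing b" "\<phi> \<in> dominated b" "f \<in> dual_space A a"
  shows "(\<lambda>\<alpha>. cmod (\<phi> \<alpha> * cnj (f \<alpha>))) summable_on ell A"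
  using assms(2)
  by (intro summable_on_comparison_test[OF seminorm_summable[OF assms(1,3)]])
     (auto simp: norm_mult dominated_def intro: mult_right_mono)

lemma pairing_diff:
  assumes b: "rapidly_decreasing b" and \<phi>: "\<phi> \<in> dominated b"
    and f: "f \<in> dual_space A a" and g: "g \<in> dual_space A a"
  shows "pairing A \<phi> g - pairing A \<phi> f = pairing A \<phi> (\<lambda>\<alpha>. g \<alpha> - f \<alpha>)"
proof -
  have "pairing A \<phi> (\<lambda>\<alpha>. g \<alpha> - f \<alpha>) + pairing A \<phi> f
      = (\<Sum>\<^sub>\<infinity>\<alpha>\<in>ell A. \<phi> \<alpha> * cnj (g \<alpha> - f \<alpha>) + \<phi> \<alpha> * cnj (f \<alpha>))"
    unfolding pairing_def
    by (rule infsum_add[symmetric])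
       (rule abs_summable_summable[OF pairing_abs_summable[OF b \<phi>]], intro dual_space_diff f g)+
  also have "\<dots> = pairing A \<phi> g"
    by (simp add: pairing_def distrib_left[symmetric])
  finally show ?thesis by (simp add: eq_diff_eq[symmetric])
qed

lemma cmod_pairing_le:
  assumes b: "rapidly_decreasing b" and \<phi>: "\<phi> \<in> dominated b" and f: "f \<in> dual_space A a"
  shows "cmod (pairing A \<phi> f) \<le> seminorm b f"
proof -
  have "cmod (pairing A \<phi> f) \<le> (\<Sum>\<^sub>\<infinity>\<alpha>\<in>ell A. cmod (\<phi> \<alpha> * cnj (f \<alpha>)))"
    unfolding pairing_def by (rule norm_infsum_bound) (rule pairing_abs_summable[OF assms])
  also have "\<dots> \<le> seminorm b f"
    unfolding seminorm_def using \<phi>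
    by (intro infsum_mono pairing_abs_summable[OF assms] seminorm_summable[OF b f])
       (auto simp: norm_mult dominated_def intro: mult_right_mono)
  finally show ?thesis .
qed

text \<open>Giving \<phi> the phase of f removes all cancellation. That the value is attained, and
  not just approached, preserves the strict inequality when neighbourhoods are compared.\<close>

lemma pairing_attains_seminorm:
  assumes b: "rapidly_decreasing b" and f: "f \<in> dual_space A a"
  obtains \<phi> where "\<phi> \<in> dominated b" "pairing A \<phi> f = of_real (seminorm b f)"
proof -
  define \<phi> where "\<phi> \<alpha> = (if \<alpha> \<in> ell A then of_real (b \<alpha>) * sgn (f \<alpha>) else 0)" for \<alpha>
  have "\<phi> \<alpha> * cnj (f \<alpha>) = of_real (b \<alpha> * cmod (f \<alpha>))" if "\<alpha> \<in> ell A" for \<alpha>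
  proof -
    have "sgn (f \<alpha>) * cnj (f \<alpha>) = of_real (cmod (f \<alpha>))"
      by (cases "f \<alpha> = 0")
         (simp_all add: sgn_eq complex_norm_square[symmetric] power2_eq_square)
    then show ?thesis
      using that by (simp add: \<phi>_def mult.assoc)
  qed
  then have "pairing A \<phi> f = (\<Sum>\<^sub>\<infinity>\<alpha>\<in>ell A. of_real (b \<alpha> * cmod (f \<alpha>)))"
    unfolding pairing_def by (rule infsum_cong)
  also have "\<dots> = of_real (seminorm b f)"
    unfolding seminorm_def
    by (intro infsumI has_sum_of_real has_sum_infsum seminorm_summable[OF b f])
  finally show thesis
    by (rule that[rotated])
       (auto simp: dominated_def \<phi>_def norm_mult norm_sgn rapidly_decreasing_nonneg[OF b])
qed

lemma strong_nbhd_subset_seminorm_ball: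
  assumes b: "rapidly_decreasing b" and f: "f \<in> dual_space A a"
  shows "strong_nbhd A a (dominated b) \<epsilon> f \<subseteq> seminorm_ball b f \<epsilon>"
proof
  fix g assume g: "g \<in> strong_nbhd A a (dominated b) \<epsilon> f"
  obtain \<phi> where \<phi>: "\<phi> \<in> dominated b"
      "pairing A \<phi> (\<lambda>\<alpha>. g \<alpha> - f \<alpha>) = of_real (seminorm b (\<lambda>\<alpha>. g \<alpha> - f \<alpha>))"
    using pairing_attains_seminorm[OF b dual_space_diff[OF _ f], of g] g
    by (auto simp: strong_nbhd_def)
  have "g \<in> dual_space A a" "cmod (pairing A \<phi> g - pairing A \<phi> f) < \<epsilon>"
    using g \<phi>(1) by (auto simp: strong_nbhd_def)
  then show "g \<in> seminorm_ball b f \<epsilon>"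
    using pairing_diff[OF b \<phi>(1) f] \<phi>(2) by (simp add: seminorm_ball_def)
qed

lemma seminorm_ball_subset_strong_nbhd:
  assumes "rapidly_decreasing b" "B \<subseteq> dominated b" "f \<in> dual_space A a"
  shows "seminorm_ball b f \<epsilon> \<subseteq> strong_nbhd A a B \<epsilon> f"
proof
  fix g assume g: "g \<in> seminorm_ball b f \<epsilon>"
  have "cmod (pairing A \<phi> g - pairing A \<phi> f) < \<epsilon>" if "\<phi> \<in> B" for \<phi>
  proof -
    have \<phi>: "\<phi> \<in> dominated b"
      using assms(2) that by blast
    show ?thesis
      using g pairing_diff[OF assms(1) \<phi> assms(3)]
        cmod_pairing_le[OF assms(1) \<phi> dual_space_diff[OF _ assms(3)]]
      by (auto simp: seminorm_ball_def intro: le_less_trans)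
  qed
  then show "g \<in> strong_nbhd A a B \<epsilon> f"
    using g by (simp add: seminorm_ball_def strong_nbhd_def)
qed

text \<open>Boxes are bounded and every bounded set lies in a box, so the two systems of
  neighbourhoods refine each other, with the same radius.\<close>

lemma openin_strong_iff:
  "openin (strong_topology A a) U \<longleftrightarrow> U \<subseteq> dual_space A a \<and>
     (\<forall>f\<in>U. \<exists>b \<epsilon>. rapidly_decreasing b \<and> 0 < \<epsilon> \<and> seminorm_ball b f \<epsilon> \<subseteq> U)"
proof -
  have "(\<exists>B \<epsilon>. test_bounded A a B \<and> 0 < \<epsilon> \<and> strong_nbhd A a B \<epsilon> f \<subseteq> U) \<longleftrightarrow>
      (\<exists>b \<epsilon>. rapidly_decreasing b \<and> 0 < \<epsilon> \<and> seminorm_ball b f \<epsilon> \<subseteq> U)" (is "?L \<longleftrightarrow> ?R")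
    if f: "f \<in> dual_space A a" for f
  proof
    assume ?L
    then obtain B \<epsilon> where B: "test_bounded A a B" "0 < \<epsilon>" "strong_nbhd A a B \<epsilon> f \<subseteq> U"
      by blast
    obtain b where b: "rapidly_decreasing b" "B \<subseteq> dominated b"
      by (rule test_bounded_subset_dominated[OF B(1)])
    show ?R
      using b(1) B(2) subset_trans[OF seminorm_ball_subset_strong_nbhd[OF b f] B(3)] by blast
  next
    assume ?R
    then obtain b \<epsilon> where b: "rapidly_decreasing b" "0 < \<epsilon>" "seminorm_ball b f \<epsilon> \<subseteq> U"
      by blast
    show ?L
      using test_bounded_dominated[OF b(1)] b(2)
        subset_trans[OF strong_nbhd_subset_seminorm_ball[OF b(1) f] b(3)] by blast
  qed
  then show ?thesis
    unfolding openin_strong_topology by blast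
qed

lemma openin_seminorm_ball:
  assumes b: "rapidly_decreasing b" and f: "f \<in> dual_space A a"
  shows "openin (strong_topology A a) (seminorm_ball b f \<epsilon>)"
  unfolding openin_strong_iff
proof (intro conjI ballI)
  show "seminorm_ball b f \<epsilon> \<subseteq> dual_space A a"
    by (auto simp: seminorm_ball_def)
  fix g assume g: "g \<in> seminorm_ball b f \<epsilon>"
  \<comment> \<open>The radius left over at g, for use with the triangle inequality.\<close>
  define \<delta> where "\<delta> = \<epsilon> - seminorm b (\<lambda>\<alpha>. g \<alpha> - f \<alpha>)"
  have "seminorm_ball b g \<delta> \<subseteq> seminorm_ball b f \<epsilon>"
  proof
    fix h assume h: "h \<in> seminorm_ball b g \<delta>"
    have "seminorm b (\<lambda>\<alpha>. (h \<alpha> - g \<alpha>) + (g \<alpha> - f \<alpha>))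
        \<le> seminorm b (\<lambda>\<alpha>. h \<alpha> - g \<alpha>) + seminorm b (\<lambda>\<alpha>. g \<alpha> - f \<alpha>)"
      using g h f by (intro seminorm_triangle[OF b] dual_space_diff) (auto simp: seminorm_ball_def)
    then show "h \<in> seminorm_ball b f \<epsilon>"
      using h by (simp add: seminorm_ball_def \<delta>_def)
  qed
  moreover have "0 < \<delta>"
    using g by (simp add: \<delta>_def seminorm_ball_def)
  ultimately show "\<exists>b' \<delta>. rapidly_decreasing b' \<and> 0 < \<delta> \<and> seminorm_ball b' g \<delta> \<subseteq> seminorm_ball b f \<epsilon>"
    using b by blast
qed

lemma centre_in_seminorm_ball: "f \<in> dual_space A a \<Longrightarrow> 0 < \<epsilon> \<Longrightarrow> f \<in> seminorm_ball b f \<epsilon>"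
  by (simp add: seminorm_ball_def)

subsection \<open>Continuity of the algebra operations\<close>

text \<open>The source is an arbitrary topological space, so that the criterion serves for products
  as well as for the scalars.\<close>

lemma continuous_map_strongI:
  assumes dual: "\<And>x. x \<in> topspace S \<Longrightarrow> h x \<in> dual_space A a"
    and local: "\<And>x b \<epsilon>. \<lbrakk>x \<in> topspace S; rapidly_decreasing b; 0 < \<epsilon>\<rbrakk> \<Longrightarrow>
      \<exists>W. openin S W \<and> x \<in> W \<and> (\<forall>y\<in>W. seminorm b (\<lambda>\<alpha>. h y \<alpha> - h x \<alpha>) < \<epsilon>)"
  shows "continuous_map S (strong_topology A a) h"
  unfolding continuous_map_def topspace_strong_topology
proof (intro conjI allI impI)
  show "h \<in> topspace S \<rightarrow> dual_space A a"
    using dual by auto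
  fix U assume U: "openin (strong_topology A a) U"
  show "openin S {x \<in> topspace S. h x \<in> U}"
  proof (subst openin_subopen, intro ballI)
    fix x assume x: "x \<in> {x \<in> topspace S. h x \<in> U}"
    then obtain b \<epsilon> where b: "rapidly_decreasing b" "0 < \<epsilon>" "seminorm_ball b (h x) \<epsilon> \<subseteq> U"
      using U unfolding openin_strong_iff by blast
    obtain W where W: "openin S W" "x \<in> W" "\<forall>y\<in>W. seminorm b (\<lambda>\<alpha>. h y \<alpha> - h x \<alpha>) < \<epsilon>"
      using local[OF _ b(1,2), of x] x by blast
    have "W \<subseteq> topspace S"
      using W(1) by (rule openin_subset)
    with W(3) b(3) dual have "W \<subseteq> {x \<in> topspace S. h x \<in> U}"
      by (auto simp: seminorm_ball_def)
    with W(1,2) show "\<exists>T. openin S T \<and> x \<in> T \<and> T \<subseteq> {x \<in> topspace S. h x \<in> U}"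
      by blast
  qed
qed

lemma continuous_map_strong_pairI:
  assumes dual: "\<And>f g. \<lbrakk>f \<in> dual_space A a; g \<in> dual_space A a\<rbrakk> \<Longrightarrow> h f g \<in> dual_space A a"
    and local: "\<And>f g b \<epsilon>. \<lbrakk>f \<in> dual_space A a; g \<in> dual_space A a; rapidly_decreasing b; 0 < \<epsilon>\<rbrakk> \<Longrightarrow>
      \<exists>b' \<delta>. rapidly_decreasing b' \<and> 0 < \<delta> \<and> (\<forall>f'\<in>seminorm_ball b' f \<delta>. \<forall>g'\<in>seminorm_ball b' g \<delta>.
        seminorm b (\<lambda>\<alpha>. h f' g' \<alpha> - h f g \<alpha>) < \<epsilon>)"
  shows "continuous_map (prod_topology (strong_topology A a) (strong_topology A a))
    (strong_topology A a) (\<lambda>(f, g). h f g)"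
proof (rule continuous_map_strongI)
  fix x assume "x \<in> topspace (prod_topology (strong_topology A a) (strong_topology A a))"
  then obtain f g where x: "x = (f, g)" "f \<in> dual_space A a" "g \<in> dual_space A a"
    by (auto simp: topspace_strong_topology)
  then show "(case x of (f, g) \<Rightarrow> h f g) \<in> dual_space A a"
    by (simp add: dual)
  fix b and \<epsilon> :: real assume b: "rapidly_decreasing b" "0 < \<epsilon>"
  obtain b' \<delta> where b': "rapidly_decreasing b'" "0 < \<delta>"
      "\<forall>f'\<in>seminorm_ball b' f \<delta>. \<forall>g'\<in>seminorm_ball b' g \<delta>.
        seminorm b (\<lambda>\<alpha>. h f' g' \<alpha> - h f g \<alpha>) < \<epsilon>"
    using local[OF x(2,3) b] by (elim exE conjE)
  let ?W = "seminorm_ball b' f \<delta> \<times> seminorm_ball b' g \<delta>"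
  have "openin (prod_topology (strong_topology A a) (strong_topology A a)) ?W"
    using b' x by (simp add: openin_prod_Times_iff openin_seminorm_ball)
  moreover have "x \<in> ?W"
    using b' x by (simp add: centre_in_seminorm_ball)
  ultimately show "\<exists>W. openin (prod_topology (strong_topology A a) (strong_topology A a)) W \<and> x \<in> W \<and>
      (\<forall>y\<in>W. seminorm b (\<lambda>\<alpha>. (case y of (f, g) \<Rightarrow> h f g) \<alpha> - (case x of (f, g) \<Rightarrow> h f g) \<alpha>) < \<epsilon>)"
    using b'(3) x(1) by (intro exI[of _ ?W]) auto
qed

lemma continuous_map_add:
  "continuous_map (prod_topology (strong_topology A a) (strong_topology A a))
    (strong_topology A a) (\<lambda>(f, g). \<lambda>\<gamma>. f \<gamma> + g \<gamma>)"
proof (rule continuous_map_strong_pairI)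
  fix f g b and \<epsilon> :: real
  assume fg: "f \<in> dual_space A a" "g \<in> dual_space A a" and b: "rapidly_decreasing b" and "0 < \<epsilon>"
  have "seminorm b (\<lambda>\<alpha>. f' \<alpha> + g' \<alpha> - (f \<alpha> + g \<alpha>)) < \<epsilon>"
    if "f' \<in> seminorm_ball b f (\<epsilon> / 2)" "g' \<in> seminorm_ball b g (\<epsilon> / 2)" for f' g'
  proof -
    have "seminorm b (\<lambda>\<alpha>. (f' \<alpha> - f \<alpha>) + (g' \<alpha> - g \<alpha>))
        \<le> seminorm b (\<lambda>\<alpha>. f' \<alpha> - f \<alpha>) + seminorm b (\<lambda>\<alpha>. g' \<alpha> - g \<alpha>)"
      using that fg by (intro seminorm_triangle[OF b] dual_space_diff) (auto simp: seminorm_ball_def)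
    then show ?thesis
      using that by (simp add: seminorm_ball_def add_diff_add)
  qed
  then show "\<exists>b' \<delta>. rapidly_decreasing b' \<and> 0 < \<delta> \<and> (\<forall>f'\<in>seminorm_ball b' f \<delta>.
      \<forall>g'\<in>seminorm_ball b' g \<delta>. seminorm b (\<lambda>\<alpha>. f' \<alpha> + g' \<alpha> - (f \<alpha> + g \<alpha>)) < \<epsilon>)"
    using b \<open>0 < \<epsilon>\<close> by (intro exI[of _ b] exI[of _ "\<epsilon> / 2"]) auto
qed (rule dual_space_add)

lemma continuous_map_convolution:
  "continuous_map (prod_topology (strong_topology A a) (strong_topology A a))
    (strong_topology A a) (\<lambda>(f, g). convolution A f g)"
proof (rule continuous_map_strong_pairI)
  fix f g b and \<epsilon> :: real
  assume fg: "f \<in> dual_space A a" "g \<in> dual_space A a" and b: "rapidly_decreasing b" and "0 < \<epsilon>"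
  obtain b' where b': "rapidly_decreasing b'"
      "\<forall>\<alpha>\<in>ell A. \<forall>\<beta>\<in>ell A. b (\<alpha> + \<beta>) \<le> b' \<alpha> * b' \<beta>"
    using rapidly_decreasing_factor[OF b] by (elim exE conjE)
  note conv_le = seminorm_convolution_le[OF b b']
  define M where "M = seminorm b' f + seminorm b' g"
  have M: "0 \<le> M"
    unfolding M_def by (intro add_nonneg_nonneg seminorm_nonneg b')
  \<comment> \<open>The bound 1 tames the quadratic term and leaves
    \<open>\<delta> * (1 + M)\<close> in all; 2 in place of 1 makes the final estimate
    strict.\<close>
  define \<delta> where "\<delta> = min 1 (\<epsilon> / (2 + M))"
  have \<delta>: "0 < \<delta>" "\<delta> \<le> 1" "\<delta> \<le> \<epsilon> / (2 + M)"
    using M \<open>0 < \<epsilon>\<close> by (simp_all add: \<delta>_def)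
  have "seminorm b (\<lambda>\<alpha>. convolution A f' g' \<alpha> - convolution A f g \<alpha>) < \<epsilon>"
    if f': "f' \<in> seminorm_ball b' f \<delta>" and g': "g' \<in> seminorm_ball b' g \<delta>" for f' g'
  proof -
    define u v where "u = (\<lambda>\<alpha>. f' \<alpha> - f \<alpha>)" and "v = (\<lambda>\<alpha>. g' \<alpha> - g \<alpha>)"
    have uv: "u \<in> dual_space A a" "v \<in> dual_space A a" "seminorm b' u < \<delta>" "seminorm b' v < \<delta>"
      using f' g' fg by (auto simp: u_def v_def seminorm_ball_def intro: dual_space_diff)
    have nonneg: "0 \<le> seminorm b' u" "0 \<le> seminorm b' v" "0 \<le> seminorm b' f" "0 \<le> seminorm b' g"
      by (rule seminorm_nonneg[OF b'(1)])+
    note conv_dual = dual_space_convolution[OF uv(1,2)] dual_space_convolution[OF uv(1) fg(2)]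
      dual_space_convolution[OF fg(1) uv(2)]
    \<comment> \<open>The product is expanded at (f, g) with increments u and v, so that the
      constant involves only the seminorms of the fixed f and g.\<close>
    have "seminorm b (\<lambda>\<alpha>. convolution A f' g' \<alpha> - convolution A f g \<alpha>) =
        seminorm b (\<lambda>\<alpha>. (convolution A u v \<alpha> + convolution A u g \<alpha>) + convolution A f v \<alpha>)"
      by (simp add: u_def v_def convolution_diff_left convolution_diff_right)
    also have "\<dots> \<le> seminorm b (\<lambda>\<alpha>. convolution A u v \<alpha> + convolution A u g \<alpha>)
        + seminorm b (convolution A f v)"
      by (rule seminorm_triangle[OF b dual_space_add[OF conv_dual(1,2)] conv_dual(3)])
    also have "\<dots> \<le> seminorm b (convolution A u v) + seminorm b (convolution A u g)
        + seminorm b (convolution A f v)"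
      by (rule add_right_mono[OF seminorm_triangle[OF b conv_dual(1,2)]])
    also have "\<dots> \<le> seminorm b' u * seminorm b' v + seminorm b' u * seminorm b' g
        + seminorm b' f * seminorm b' v"
      by (intro add_mono conv_le uv fg)
    also have "\<dots> \<le> 1 * \<delta> + \<delta> * seminorm b' g + seminorm b' f * \<delta>"
      using uv nonneg \<delta> by (intro add_mono mult_mono) auto
    also have "\<dots> = \<delta> * (1 + M)"
      by (simp add: M_def algebra_simps)
    also have "\<dots> < \<delta> * (2 + M)"
      using \<delta>(1) by (intro mult_strict_left_mono) auto
    also have "\<dots> \<le> \<epsilon>"
      using \<delta>(3) M by (simp add: pos_le_divide_eq)
    finally show ?thesis .
  qed
  then show "\<exists>b' \<delta>. rapidly_decreasing b' \<and> 0 < \<delta> \<and> (\<forall>f'\<in>seminorm_ball b' f \<delta>.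
      \<forall>g'\<in>seminorm_ball b' g \<delta>. seminorm b (\<lambda>\<alpha>. convolution A f' g' \<alpha> - convolution A f g \<alpha>) < \<epsilon>)"
    using b'(1) \<delta>(1) by blast
qed (rule dual_space_convolution)

text \<open>Only the coordinate 0 varies, so the seminorm of a difference is \<open>b 0\<close>
  times the distance of the scalars.\<close>

lemma continuous_map_const_embedding:
  "continuous_map euclidean (strong_topology A a) (\<lambda>c \<gamma>. if \<gamma> = 0 then c else 0)"
proof (rule continuous_map_strongI)
  fix c :: complex and b and \<epsilon> :: real
  assume b: "rapidly_decreasing b" and "0 < \<epsilon>"
  have b0: "0 \<le> b 0"
    by (rule rapidly_decreasing_nonneg[OF b zero_in_ell])
  \<comment> \<open>The 1 in the denominator covers the case \<open>b 0 = 0\<close> and gives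
    strictness.\<close>
  have "seminorm b (\<lambda>\<gamma>. (if \<gamma> = 0 then c' else 0) - (if \<gamma> = 0 then c else 0)) < \<epsilon>"
    if "c' \<in> ball c (\<epsilon> / (1 + b 0))" for c'
  proof -
    have "seminorm b (\<lambda>\<gamma>. (if \<gamma> = 0 then c' else 0) - (if \<gamma> = 0 then c else 0))
        = b 0 * cmod (c' - c)"
      unfolding seminorm_const[symmetric] by (rule arg_cong[of _ _ "seminorm b"]) auto
    also have "\<dots> \<le> b 0 * (\<epsilon> / (1 + b 0))"
      using that b0 by (intro mult_left_mono) (auto simp: dist_norm norm_minus_commute)
    also have "\<dots> < \<epsilon>"
      using b0 \<open>0 < \<epsilon>\<close> by (simp add: field_simps)
    finally show ?thesis .
  qed
  then show "\<exists>W. openin euclidean W \<and> c \<in> W \<and>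
      (\<forall>y\<in>W. seminorm b (\<lambda>\<alpha>. (if \<alpha> = 0 then y else 0) - (if \<alpha> = 0 then c else 0)) < \<epsilon>)"
    using b0 \<open>0 < \<epsilon>\<close> by (intro exI[of _ "ball c (\<epsilon> / (1 + b 0))"]) auto
qed (rule dual_space_const)

lemma continuous_map_scale:
  "continuous_map (prod_topology euclidean (strong_topology A a)) (strong_topology A a)
    (\<lambda>(c, f). \<lambda>\<gamma>. c * f \<gamma>)"
proof (rule continuous_map_eq)
  let ?S = "prod_topology (euclidean :: complex topology) (strong_topology A a)"
  let ?pair = "\<lambda>x. ((\<lambda>\<gamma>. if \<gamma> = 0 then fst x else 0), snd x)"
  have "continuous_map ?S (prod_topology (strong_topology A a) (strong_topology A a)) ?pair"
    by (intro continuous_map_pairedI continuous_map_snd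
          continuous_map_compose[OF continuous_map_fst continuous_map_const_embedding, unfolded o_def])
  then show "continuous_map ?S (strong_topology A a) ((\<lambda>(f, g). convolution A f g) \<circ> ?pair)"
    by (rule continuous_map_compose) (rule continuous_map_convolution)
  \<comment> \<open>Agreement is asked only on \<open>topspace ?S\<close>, where f vanishes off
    \<open>ell A\<close>, as the convolution does.\<close>
  show "((\<lambda>(f, g). convolution A f g) \<circ> ?pair) x = (case x of (c, f) \<Rightarrow> \<lambda>\<gamma>. c * f \<gamma>)"
    if "x \<in> topspace ?S" for x
    using that by (auto simp: topspace_strong_topology convolution_const_left dual_space_outside)
qed

section \<open>Ring and algebra laws\<close>

lemma dual_algebra_abelian_group: "abelian_group (dual_algebra A a)"
proof (rule abelian_groupI)
  fix f assume "f \<in> carrier (dual_algebra A a)"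
  then have "(\<lambda>\<gamma>. - f \<gamma>) \<in> dual_space A a"
    using dual_space_scale[of f "-1"] by (simp add: dual_algebra_def)
  then show "\<exists>g\<in>carrier (dual_algebra A a). g \<oplus>\<^bsub>dual_algebra A a\<^esub> f = \<zero>\<^bsub>dual_algebra A a\<^esub>"
    by (intro bexI[of _ "\<lambda>\<gamma>. - f \<gamma>"]) (auto simp: dual_algebra_def)
qed (auto simp: dual_algebra_def dual_space_add dual_space_zero add_ac)

lemma dual_algebra_cring: "cring (dual_algebra A a)"
proof (rule cringI[OF dual_algebra_abelian_group])
  show "comm_monoid (dual_algebra A a)"
  proof (rule comm_monoidI)
    fix f g
    show "f \<otimes>\<^bsub>dual_algebra A a\<^esub> g = g \<otimes>\<^bsub>dual_algebra A a\<^esub> f"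
      by (simp add: dual_algebra_def convolution_commute[of A f])
  qed (auto simp: dual_algebra_def dual_space_convolution dual_space_const convolution_assoc
      convolution_const_left dual_space_outside)
qed (simp add: dual_algebra_def convolution_add_left)

lemma dual_algebra_algebra: "algebra ring_of_type_algebra (dual_algebra A a)"
proof (rule algebraI[OF cring_from_type_algebra dual_algebra_cring])
  fix c f g
  assume "f \<in> carrier (dual_algebra A a)" "g \<in> carrier (dual_algebra A a)"
  then have fg: "f \<in> dual_space A a" "g \<in> dual_space A a"
    by (simp_all add: dual_algebra_def)
  \<comment> \<open>Compatibility with scalars is associativity with c times the unit as first
    factor.\<close>
  have "convolution A (\<lambda>\<gamma>. c * f \<gamma>) g = (\<lambda>\<gamma>. c * convolution A f g \<gamma>)"
    using convolution_assoc[of A "\<lambda>\<gamma>. if \<gamma> = 0 then c else 0" f g] fg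
    by (simp add: convolution_const_left dual_space_outside convolution_outside)
  then show "(c \<odot>\<^bsub>dual_algebra A a\<^esub> f) \<otimes>\<^bsub>dual_algebra A a\<^esub> g
      = c \<odot>\<^bsub>dual_algebra A a\<^esub> (f \<otimes>\<^bsub>dual_algebra A a\<^esub> g)"
    by (simp add: dual_algebra_def)
qed (auto simp: dual_algebra_def ring_of_type_algebra_def dual_space_scale algebra_simps)

theorem topological_complex_algebra_dual:
  "topological_complex_algebra (strong_topology A a) (dual_algebra A a)"
  unfolding topological_complex_algebra_def
  using dual_algebra_algebra continuous_map_add continuous_map_scale continuous_map_convolution
  by (simp add: topspace_strong_topology dual_algebra_def)

end

theorem theorem3p6:
  fixes A :: "nat set" and a :: "multi_index \<Rightarrow> real"
  assumes "A \<subseteq> {1..}" and "vage_space A a"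
  shows "continuous_map (prod_topology (strong_topology A a) (strong_topology A a))
           (strong_topology A a) (\<lambda>(f, g). convolution A f g) \<and>
         topological_complex_algebra (strong_topology A a) (dual_algebra A a)"
proof -
  interpret supermultiplicative_weight A a
    using assms(2) vage_space_weight_ge_one vage_space_supermultiplicative vage_space_inverse_summable
    by unfold_locales auto
  show ?thesis
    using continuous_map_convolution topological_complex_algebra_dual ..
qed

end
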